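(* For all $r,s\in(0,\infty)$, $\Lambda(\ell_s(\ell_r))=\{r,s\}$.
   Context: Spaces are over the real or complex field. For a quasi-Banach space $X$, $\Lambda(X)=\{p\in(0,\infty] : \ell_p \text{ isomorphically embeds into } X\}$, with the convention that for $p=\infty$ the symbol $\ell_\infty$ means $c_0$. "Isomorphically embeds" means that there is a linear homeomorphism onto a closed subspace. $\ell_s(\ell_r)$ is the quasi-Banach space of sequences $(x_n)_{n=1}^\infty$ in $\ell_r$ with quasi-norm $(\sum_n\|x_n\|_{\ell_r}^s)^{1/s}<\infty$. *)

theory Defs
  imports "HOL-Analysis.Analysis" "HOL-Library.Function_Algebras"
begin

text \<open>A (quasi-normed) space is represented by its underlying set in an ambient abelian group, its
  multiplication by scalars, and its quasi-norm.  The sequence spaces below carry the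
  pointwise addition of \<^theory>\<open>HOL-Library.Function_Algebras\<close>.\<close>

record ('k, 'v) qn_space =
  carrier :: "'v set"
  smult :: "'k \<Rightarrow> 'v \<Rightarrow> 'v"
  qnorm :: "'v \<Rightarrow> real"

definition ell :: "real \<Rightarrow> ('k::real_normed_field, nat \<Rightarrow> 'k) qn_space" where
  "ell p = \<lparr>carrier = {x. summable (\<lambda>n. norm (x n) powr p)},
            smult = (\<lambda>c x n. c * x n),
            qnorm = (\<lambda>x. (\<Sum>n. norm (x n) powr p) powr (1 / p))\<rparr>"

definition c_zero :: "('k::real_normed_field, nat \<Rightarrow> 'k) qn_space" where
  "c_zero = \<lparr>carrier = {x. x \<longlonglongrightarrow> 0},
             smult = (\<lambda>c x n. c * x n),
             qnorm = (\<lambda>x. SUP n. norm (x n))\<rparr>"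

text \<open>\<open>ell_of s X\<close> is the space \<open>\<ell>\<^sub>s(X)\<close> of \<open>s\<close>-summable sequences in \<open>X\<close>.\<close>

definition ell_of :: "real \<Rightarrow> ('k, 'v) qn_space \<Rightarrow> ('k, nat \<Rightarrow> 'v) qn_space" where
  "ell_of s X = \<lparr>carrier = {x. (\<forall>n. x n \<in> carrier X) \<and> summable (\<lambda>n. qnorm X (x n) powr s)},
                 smult = (\<lambda>c x n. smult X c (x n)),
                 qnorm = (\<lambda>x. (\<Sum>n. qnorm X (x n) powr s) powr (1 / s))\<rparr>"

text \<open>In the topology of a quasi-norm, the balls around a point form a base of its neighbourhoods,
  although they need not be open.\<close>

definition qn_topology :: "('k, 'v::ab_group_add) qn_space \<Rightarrow> 'v topology" where
  "qn_topology X = topology (\<lambda>U. U \<subseteq> carrier X \<and>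
     (\<forall>x\<in>U. \<exists>e>0. \<forall>y\<in>carrier X. qnorm X (y - x) < e \<longrightarrow> y \<in> U))"

lemma openin_qn_topology:
  "openin (qn_topology X) U \<longleftrightarrow> U \<subseteq> carrier X \<and>
     (\<forall>x\<in>U. \<exists>e>0. \<forall>y\<in>carrier X. qnorm X (y - x) < e \<longrightarrow> y \<in> U)"
proof -
  define L where "L = (\<lambda>U. U \<subseteq> carrier X \<and>
     (\<forall>x\<in>U. \<exists>e>0. \<forall>y\<in>carrier X. qnorm X (y - x) < e \<longrightarrow> y \<in> U))"
  have "L (S \<inter> T)" if S: "L S" and T: "L T" for S T
    unfolding L_def
  proof (intro conjI ballI)
    show "S \<inter> T \<subseteq> carrier X"
      using S by (auto simp: L_def)
    fix x assume x: "x \<in> S \<inter> T"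
    obtain d where d: "d > 0" "\<And>y. y \<in> carrier X \<Longrightarrow> qnorm X (y - x) < d \<Longrightarrow> y \<in> S"
      using S x unfolding L_def by blast
    obtain e where e: "e > 0" "\<And>y. y \<in> carrier X \<Longrightarrow> qnorm X (y - x) < e \<Longrightarrow> y \<in> T"
      using T x unfolding L_def by blast
    show "\<exists>e>0. \<forall>y\<in>carrier X. qnorm X (y - x) < e \<longrightarrow> y \<in> S \<inter> T"
      using d e by (intro exI[of _ "min d e"]) auto
  qed
  moreover have "L (\<Union>K)" if K: "\<forall>U\<in>K. L U" for K
    unfolding L_def
  proof (intro conjI ballI)
    show "\<Union>K \<subseteq> carrier X"
      using K by (auto simp: L_def)
    fix x assume "x \<in> \<Union>K"
    then obtain U where U: "U \<in> K" "x \<in> U" by blast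
    then have "L U" using K by blast
    then obtain e where "e > 0" "\<forall>y\<in>carrier X. qnorm X (y - x) < e \<longrightarrow> y \<in> U"
      using U unfolding L_def by blast
    then show "\<exists>e>0. \<forall>y\<in>carrier X. qnorm X (y - x) < e \<longrightarrow> y \<in> \<Union>K"
      using U by (intro exI[of _ e]) auto
  qed
  ultimately have "istopology L"
    by (simp add: istopology_def)
  then have "openin (topology L) U = L U"
    by (simp add: topology_inverse')
  then show ?thesis
    by (simp only: qn_topology_def L_def)
qed

lemma topspace_qn_topology: "topspace (qn_topology X) = carrier X"
proof
  show "topspace (qn_topology X) \<subseteq> carrier X"
    using openin_topspace openin_qn_topology by blast
  have "openin (qn_topology X) (carrier X)"
    by (auto simp: openin_qn_topology intro: exI[of _ 1])
  then show "carrier X \<subseteq> topspace (qn_topology X)"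
    by (rule openin_subset)
qed

definition linear_map_between ::
    "('k, 'v::ab_group_add) qn_space \<Rightarrow> ('k, 'w::ab_group_add) qn_space \<Rightarrow> ('v \<Rightarrow> 'w) \<Rightarrow> bool" where
  "linear_map_between X Y T \<longleftrightarrow>
     T \<in> carrier X \<rightarrow> carrier Y \<and>
     (\<forall>x\<in>carrier X. \<forall>y\<in>carrier X. T (x + y) = T x + T y) \<and>
     (\<forall>c. \<forall>x\<in>carrier X. T (smult X c x) = smult Y c (T x))"

definition isomorphically_embeds ::
    "('k, 'v::ab_group_add) qn_space \<Rightarrow> ('k, 'w::ab_group_add) qn_space \<Rightarrow> bool" where
  "isomorphically_embeds X Y \<longleftrightarrow> (\<exists>T. linear_map_between X Y T \<and>
     embedding_map (qn_topology X) (qn_topology Y) T \<and>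
     closedin (qn_topology Y) (T ` carrier X))"

definition Lambda :: "('k::real_normed_field, 'v::ab_group_add) qn_space \<Rightarrow> ereal set" where
  "Lambda X = {p. 0 < p \<and>
     isomorphically_embeds (if p = \<infinity> then c_zero else ell (real_of_ereal p)) X}"

end

theory Submission
  imports Defs "HOL-Complex_Analysis.Great_Picard" "HOL-Real_Asymp.Real_Asymp"
begin

text \<open>That \<open>\<ell>\<^sub>r\<close> and \<open>\<ell>\<^sub>s\<close> embed is clear: one sits in a single outer coordinate, the other in a single
  inner coordinate (\<open>embeds_in_ell_of\<close>, \<open>outer_ell_embeds\<close>).

  For the converse, an embedded copy of \<open>\<ell>\<^sub>p\<close> (or of \<open>c\<^sub>0\<close>, with \<open>1 / p = 0\<close>) contains a sequence of images
  of unit vectors, in which signed sums of \<open>N\<close> terms have quasi-norm of order \<open>N powr (1 / p)\<close>.  By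
  compactness a sequence \<open>u n\<close> of differences of such terms tends to \<open>0\<close> in every entry, while the
  quantities \<open>\<parallel>u n i\<parallel>\<^sup>r\<close> converge to some \<open>\<alpha> i\<close> in every row \<open>i\<close>, and \<open>\<parallel>u n\<parallel>\<^sup>s\<close> converges to some \<open>L\<close>.
  The Brezis--Lieb lemma (\<open>brezis_lieb\<close>), which holds for all positive exponents, says that adding a
  coordinatewise null sequence adds up \<open>r\<close>-th powers in \<open>\<ell>\<^sub>r\<close>.  Applying it in the rows, and its idea once
  more across the rows (\<open>\<Phi>_add_tendsto\<close>), shows that the \<open>s\<close>-th power of the quasi-norm of a sum of \<open>N\<close>
  suitably chosen terms is arbitrarily close to \<open>N powr (s / r) * P + N * Q\<close> with
  \<open>P = (\<Sum>i. \<alpha> i powr (s / r))\<close> and \<open>Q = L - P\<close>, both nonnegative (\<open>sum_energy_growth\<close>).  This must have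
  the order of \<open>N powr (s / p)\<close>, so that \<open>s / p\<close> is \<open>s / r\<close> or \<open>1\<close> (\<open>powr_sum_growth_exponent\<close>).\<close>

section \<open>Powers and almost dominated series\<close>

lemma powr_add_le:
  fixes a b t :: real
  assumes "0 \<le> a" "0 \<le> b" "0 < t"
  shows "(a + b) powr t \<le> 2 powr t * (a powr t + b powr t)"
proof -
  have "(a + b) powr t \<le> (2 * max a b) powr t"
    using assms by (intro powr_mono2) auto
  also have "\<dots> = 2 powr t * max a b powr t"
    using assms by (simp add: powr_mult)
  also have "\<dots> \<le> 2 powr t * (a powr t + b powr t)"
    by (intro mult_left_mono) (auto simp: max_def)
  finally show ?thesis .
qed

text \<open>If \<open>z\<close> is small compared with \<open>b\<close>, then \<open>b' / b\<close> is close to \<open>1\<close>, where \<open>y powr t\<close> is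
  continuous; otherwise \<open>b\<close> and \<open>b'\<close> are both bounded by a multiple of \<open>z\<close>.\<close>

lemma powr_perturbation:
  fixes t \<epsilon> :: real
  assumes "0 < t" "0 < \<epsilon>"
  obtains \<delta> C :: real where "0 < \<delta>" "0 \<le> C"
    "\<And>b b' z. \<lbrakk>0 \<le> b; 0 \<le> b'; 0 \<le> z; \<bar>b' - b\<bar> \<le> \<delta> * b + z\<rbrakk>
       \<Longrightarrow> \<bar>b' powr t - b powr t\<bar> \<le> \<epsilon> * b powr t + C * z powr t"
proof -
  have "((\<lambda>y::real. y powr t) \<longlongrightarrow> 1 powr t) (at 1)"
    by (intro tendsto_intros) auto
  then have "\<forall>\<^sub>F y::real in at 1. dist (y powr t) (1 powr t) < \<epsilon>"
    using assms by (auto dest: tendstoD)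
  then obtain d where d: "d > 0" "\<And>y::real. y \<noteq> 1 \<Longrightarrow> dist y 1 < d \<Longrightarrow> dist (y powr t) 1 < \<epsilon>"
    unfolding eventually_at by auto
  \<comment> \<open>In the first case below, \<open>b' / b\<close> differs from \<open>1\<close> by at most \<open>2 * \<delta> < d\<close>.\<close>
  define \<delta> where "\<delta> = d / 4"
  define B where "B = (1 + \<delta>) / \<delta> + 1"
  have \<delta>: "\<delta> > 0" using d by (simp add: \<delta>_def)
  have B: "B > 0" "1 / \<delta> \<le> B" using \<delta> by (auto simp: B_def field_simps)
  show thesis
  proof (rule that[of \<delta> "B powr t"])
    fix b b' z :: real
    assume nn: "0 \<le> b" "0 \<le> b'" "0 \<le> z" and close: "\<bar>b' - b\<bar> \<le> \<delta> * b + z"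
    show "\<bar>b' powr t - b powr t\<bar> \<le> \<epsilon> * b powr t + B powr t * z powr t"
    proof (cases "z \<le> \<delta> * b \<and> b > 0")
      case True
      then have "\<bar>b' - b\<bar> \<le> 2 * \<delta> * b" using close by simp
      then have "\<bar>b' / b - 1\<bar> \<le> 2 * \<delta>" using True by (simp add: field_simps abs_le_iff)
      then have "\<bar>(b' / b) powr t - 1\<bar> \<le> \<epsilon>"
        using d(2)[of "b' / b"] d(1) assms by (cases "b' / b = 1") (auto simp: dist_real_def \<delta>_def)
      then have "\<bar>(b' / b) powr t - 1\<bar> * b powr t \<le> \<epsilon> * b powr t"
        by (intro mult_right_mono) auto
      also have "\<bar>(b' / b) powr t - 1\<bar> * b powr t = \<bar>((b' / b) powr t - 1) * b powr t\<bar>"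
        by (simp add: abs_mult)
      also have "((b' / b) powr t - 1) * b powr t = b' powr t - b powr t"
        using True nn by (simp add: powr_divide algebra_simps)
      finally show ?thesis by (simp add: add_increasing2)
    next
      case False
      then have "b \<le> z / \<delta>" using nn \<delta> by (auto simp: field_simps)
      moreover have "b' \<le> (1 + \<delta>) * b + z" using close by (simp add: algebra_simps abs_le_iff)
      ultimately have "b' \<le> (1 + \<delta>) * (z / \<delta>) + z"
        using \<delta> by (meson add_right_mono mult_left_mono order_trans add_nonneg_nonneg less_imp_le zero_le_one)
      then have b': "b' \<le> B * z" by (simp add: B_def algebra_simps)
      have "b \<le> B * z" using \<open>b \<le> z / \<delta>\<close> mult_right_mono[OF B(2), of z] nn by simp
      with b' have "b' powr t \<le> (B * z) powr t" "b powr t \<le> (B * z) powr t"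
        using nn assms by (auto intro: powr_mono2)
      then have "\<bar>b' powr t - b powr t\<bar> \<le> (B * z) powr t"
        by (smt (verit) powr_ge_zero)
      also have "\<dots> = B powr t * z powr t" using nn B by (simp add: powr_mult)
      finally show ?thesis using assms by (simp add: add_increasing)
    qed
  qed (use \<delta> in auto)
qed

text \<open>Tannery's theorem under a weaker domination, which is the form in which Brezis and Lieb use it:
  the summands may exceed a fixed summable sequence by an arbitrarily small multiple of sequences
  with bounded sums.  Tails are then uniformly small, and the initial segments converge.\<close>

lemma suminf_tendsto_almost_dominated:
  fixes \<Delta> G :: "nat \<Rightarrow> nat \<Rightarrow> real"
  assumes dom: "\<And>\<epsilon>. 0 < \<epsilon> \<Longrightarrow> \<exists>k. summable k \<and> (\<forall>n i. \<bar>\<Delta> n i\<bar> \<le> \<epsilon> * G n i + k i)"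
    and G: "\<And>n i. 0 \<le> G n i" "\<And>n. summable (G n)" "\<And>n. suminf (G n) \<le> M"
    and lim: "\<And>i. (\<lambda>n. \<Delta> n i) \<longlonglongrightarrow> H i"
  shows "\<And>n. summable (\<Delta> n)" "summable H" "(\<lambda>n. suminf (\<Delta> n)) \<longlonglongrightarrow> suminf H"
proof -
  obtain k1 where k1: "summable k1" "\<And>n i. \<bar>\<Delta> n i\<bar> \<le> 1 * G n i + k1 i"
    using dom[of 1] by auto
  have M: "0 \<le> M" using suminf_nonneg[OF G(2) G(1)] G(3) by (meson order_trans)
  show sD: "summable (\<Delta> n)" for n
    by (rule summable_comparison_test'[where N=0 and g="\<lambda>i. G n i + k1 i"])
      (use k1 G in \<open>auto intro: summable_add\<close>)
  have k1_nn: "0 \<le> G n i + k1 i" for n i using k1(2)[of n i] by linarith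
  have "summable (\<lambda>i. \<bar>H i\<bar>)"
  proof (rule bounded_imp_summable)
    fix m
    have "(\<lambda>n. \<Sum>i\<le>m. \<bar>\<Delta> n i\<bar>) \<longlonglongrightarrow> (\<Sum>i\<le>m. \<bar>H i\<bar>)"
      by (intro tendsto_intros lim)
    moreover have "(\<Sum>i\<le>m. \<bar>\<Delta> n i\<bar>) \<le> M + suminf k1" for n
    proof -
      have "(\<Sum>i\<le>m. \<bar>\<Delta> n i\<bar>) \<le> (\<Sum>i\<le>m. G n i + k1 i)"
        using k1(2)[of n] by (intro sum_mono) auto
      also have "\<dots> \<le> (\<Sum>i. G n i + k1 i)"
        using k1_nn G k1 by (intro sum_le_suminf) (auto intro: summable_add)
      also have "\<dots> = suminf (G n) + suminf k1"
        using suminf_add[OF G(2) k1(1)] by simp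
      finally show ?thesis using G(3)[of n] by linarith
    qed
    ultimately show "(\<Sum>i\<le>m. \<bar>H i\<bar>) \<le> M + suminf k1"
      by (meson Lim_bounded)
  qed auto
  then show sH: "summable H" by (rule summable_rabs_cancel)
  show "(\<lambda>n. suminf (\<Delta> n)) \<longlonglongrightarrow> suminf H"
  proof (rule LIMSEQ_I)
    fix e :: real assume e: "0 < e"
    define \<epsilon> where "\<epsilon> = e / (4 * (M + 1))"
    have \<epsilon>: "0 < \<epsilon>" "\<epsilon> * M \<le> e / 4"
      using M e by (auto simp: \<epsilon>_def field_simps)
    obtain k where k: "summable k" "\<And>n i. \<bar>\<Delta> n i\<bar> \<le> \<epsilon> * G n i + k i"
      using dom[OF \<epsilon>(1)] by auto
    have "\<forall>\<^sub>F m in sequentially. norm ((\<Sum>i. k (i + m)) - 0) < e / 4"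
      using e tendstoD[OF suminf_exist_split2[OF k(1)], of "e/4"] by (simp add: dist_norm)
    moreover have "\<forall>\<^sub>F m in sequentially. norm ((\<Sum>i. H (i + m)) - 0) < e / 4"
      using e tendstoD[OF suminf_exist_split2[OF sH], of "e/4"] by (simp add: dist_norm)
    ultimately obtain m where m: "\<bar>\<Sum>i. k (i + m)\<bar> < e / 4" "\<bar>\<Sum>i. H (i + m)\<bar> < e / 4"
      using eventually_happens'[OF _ eventually_conj, of sequentially] by fastforce
    have tail: "\<bar>\<Sum>i. \<Delta> n (i + m)\<bar> \<le> e / 2" for n
    proof -
      have sG: "summable (\<lambda>i. G n (i + m))" and sk: "summable (\<lambda>i. k (i + m))"
        using G(2) k(1) by (auto simp: summable_iff_shift)
      have s: "summable (\<lambda>i. \<epsilon> * G n (i + m) + k (i + m))"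
        using sG sk by (intro summable_add summable_mult)
      have s': "summable (\<lambda>i. \<bar>\<Delta> n (i + m)\<bar>)"
        by (rule summable_comparison_test'[OF s, of 0]) (use k(2) in auto)
      have "\<bar>\<Sum>i. \<Delta> n (i + m)\<bar> \<le> (\<Sum>i. \<bar>\<Delta> n (i + m)\<bar>)"
        by (rule summable_rabs[OF s'])
      also have "\<dots> \<le> (\<Sum>i. \<epsilon> * G n (i + m) + k (i + m))"
        by (intro suminf_le s s') (use k(2) in auto)
      also have "\<dots> = \<epsilon> * (\<Sum>i. G n (i + m)) + (\<Sum>i. k (i + m))"
        using sG sk by (simp add: suminf_add[symmetric] suminf_mult summable_mult)
      also have "(\<Sum>i. G n (i + m)) \<le> suminf (G n)"
        using suminf_split_initial_segment[OF G(2), of n m] G(1) by (simp add: sum_nonneg)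
      then have "\<epsilon> * (\<Sum>i. G n (i + m)) \<le> \<epsilon> * M"
        using \<epsilon>(1) G(3)[of n] by (intro mult_left_mono) auto
      finally show ?thesis using \<epsilon>(2) m(1) by linarith
    qed
    have "(\<lambda>n. \<Sum>i<m. \<Delta> n i) \<longlonglongrightarrow> (\<Sum>i<m. H i)"
      by (intro tendsto_intros lim)
    then obtain n0 where n0: "\<And>n. n \<ge> n0 \<Longrightarrow> norm ((\<Sum>i<m. \<Delta> n i) - (\<Sum>i<m. H i)) < e / 4"
      using LIMSEQ_D[of _ _ "e/4"] e by (metis zero_less_divide_iff zero_less_numeral)
    show "\<exists>no. \<forall>n\<ge>no. norm (suminf (\<Delta> n) - suminf H) < e"
    proof (intro exI allI impI)
      fix n assume "n \<ge> n0"
      then show "norm (suminf (\<Delta> n) - suminf H) < e"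
        using n0[of n] tail[of n] m(2) suminf_split_initial_segment[OF sD, of n m]
          suminf_split_initial_segment[OF sH, of m]
        unfolding real_norm_def by linarith
    qed
  qed
qed

section \<open>The Brezis--Lieb lemma for sequences\<close>

definition power_sum :: "real \<Rightarrow> (nat \<Rightarrow> 'k::real_normed_field) \<Rightarrow> real" where
  "power_sum r x = (\<Sum>j. norm (x j) powr r)"

lemma power_sum_nonneg: "summable (\<lambda>j. norm (x j) powr r) \<Longrightarrow> 0 \<le> power_sum r x"
  by (simp add: power_sum_def suminf_nonneg)

lemma summable_add_powr:
  fixes a b c :: "nat \<Rightarrow> real"
  assumes "0 < t" "\<And>i. 0 \<le> a i" "\<And>i. 0 \<le> b i" "\<And>i. 0 \<le> c i" "\<And>i. c i \<le> a i + b i"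
    and "summable (\<lambda>i. a i powr t)" "summable (\<lambda>i. b i powr t)"
  shows "summable (\<lambda>i. c i powr t)"
    and "(\<Sum>i. c i powr t) \<le> 2 powr t * ((\<Sum>i. a i powr t) + (\<Sum>i. b i powr t))"
proof -
  have le: "c i powr t \<le> 2 powr t * (a i powr t + b i powr t)" for i
    using powr_mono2[OF _ assms(4) assms(5), of t i] powr_add_le[OF assms(2,3,1), of i i] assms(1)
    by linarith
  have s: "summable (\<lambda>i. 2 powr t * (a i powr t + b i powr t))"
    by (intro summable_mult summable_add assms)
  show c: "summable (\<lambda>i. c i powr t)"
    by (rule summable_comparison_test'[OF s, of 0]) (use le in auto)
  show "(\<Sum>i. c i powr t) \<le> 2 powr t * ((\<Sum>i. a i powr t) + (\<Sum>i. b i powr t))"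
    using suminf_le[OF le c s] assms(6,7)
    by (simp add: suminf_mult suminf_add summable_add)
qed

lemma summable_norm_powr_add:
  fixes x y :: "nat \<Rightarrow> 'k::real_normed_field"
  assumes "0 < r" "summable (\<lambda>j. norm (x j) powr r)" "summable (\<lambda>j. norm (y j) powr r)"
  shows "summable (\<lambda>j. norm ((x + y) j) powr r)"
    and "power_sum r (x + y) \<le> 2 powr r * (power_sum r x + power_sum r y)"
  unfolding power_sum_def
  by (rule summable_add_powr[where a="\<lambda>j. norm (x j)" and b="\<lambda>j. norm (y j)"];
      use assms in \<open>auto intro: norm_triangle_ineq\<close>)+

lemma norm_powr_perturbation:
  assumes "0 < r" "0 < \<delta>"
  obtains C where "0 \<le> C"
    "\<And>x y :: 'k::real_normed_vector.
       \<bar>norm (x + y) powr r - norm y powr r\<bar> \<le> \<delta> * norm y powr r + C * norm x powr r"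
proof -
  obtain d C where d: "0 < d" "0 \<le> C"
    "\<And>b b' z. \<lbrakk>0 \<le> b; 0 \<le> b'; 0 \<le> z; \<bar>b' - b\<bar> \<le> d * b + z\<rbrakk>
       \<Longrightarrow> \<bar>b' powr r - b powr r\<bar> \<le> \<delta> * b powr r + C * z powr r"
    using powr_perturbation[OF assms] by metis
  show thesis
  proof (rule that[OF d(2)], rule d(3))
    fix x y :: 'k
    have "\<bar>norm (x + y) - norm y\<bar> \<le> norm x"
      using norm_triangle_ineq3[of "x + y" y] by simp
    then show "\<bar>norm (x + y) - norm y\<bar> \<le> d * norm y + norm x"
      using d(1) by (simp add: add_increasing)
  qed auto
qed

text \<open>The error \<open>\<delta> * power_sum r y\<close> is what makes \<open>powr_perturbation\<close> applicable once more when the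
  row sums are themselves raised to the power \<open>s / r\<close>.\<close>

lemma power_sum_perturbation:
  assumes "0 < r" "0 < \<delta>"
  obtains C where "0 \<le> C"
    "\<And>x y :: nat \<Rightarrow> 'k::real_normed_field. \<lbrakk>summable (\<lambda>j. norm (x j) powr r); summable (\<lambda>j. norm (y j) powr r)\<rbrakk>
       \<Longrightarrow> \<bar>power_sum r (x + y) - power_sum r y\<bar> \<le> \<delta> * power_sum r y + C * power_sum r x"
proof -
  obtain C where C: "0 \<le> C" "\<And>x y :: 'k.
       \<bar>norm (x + y) powr r - norm y powr r\<bar> \<le> \<delta> * norm y powr r + C * norm x powr r"
    using norm_powr_perturbation[OF assms] by metis
  show thesis
  proof (rule that[OF C(1)])
    fix x y :: "nat \<Rightarrow> 'k"
    assume x: "summable (\<lambda>j. norm (x j) powr r)" and y: "summable (\<lambda>j. norm (y j) powr r)"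
    note xy = summable_norm_powr_add(1)[OF assms(1) x y]
    have le: "\<bar>norm ((x + y) j) powr r - norm (y j) powr r\<bar>
        \<le> \<delta> * norm (y j) powr r + C * norm (x j) powr r" for j
      using C(2)[of "x j" "y j"] by simp
    have s: "summable (\<lambda>j. \<delta> * norm (y j) powr r + C * norm (x j) powr r)"
      by (intro summable_add summable_mult x y)
    have s': "summable (\<lambda>j. \<bar>norm ((x + y) j) powr r - norm (y j) powr r\<bar>)"
      by (rule summable_comparison_test'[OF s, of 0]) (use le in auto)
    have "\<bar>power_sum r (x + y) - power_sum r y\<bar> = \<bar>\<Sum>j. norm ((x + y) j) powr r - norm (y j) powr r\<bar>"
      unfolding power_sum_def using suminf_diff[OF xy y] by simp
    also have "\<dots> \<le> (\<Sum>j. \<bar>norm ((x + y) j) powr r - norm (y j) powr r\<bar>)"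
      by (rule summable_rabs[OF s'])
    also have "\<dots> \<le> (\<Sum>j. \<delta> * norm (y j) powr r + C * norm (x j) powr r)"
      by (rule suminf_le[OF le s' s])
    also have "\<dots> = \<delta> * power_sum r y + C * power_sum r x"
      unfolding power_sum_def using x y by (simp add: suminf_add[symmetric] suminf_mult summable_mult)
    finally show "\<bar>power_sum r (x + y) - power_sum r y\<bar> \<le> \<delta> * power_sum r y + C * power_sum r x" .
  qed
qed

text \<open>A coordinatewise null sequence is asymptotically disjoint from any fixed \<open>x\<close>: where \<open>x\<close> is large,
  \<open>u n\<close> is eventually small, and where \<open>x\<close> is small it does not matter.  So \<open>r\<close>-th powers add up.\<close>

lemma brezis_lieb:
  fixes x :: "nat \<Rightarrow> 'k::real_normed_field"
  assumes r: "0 < r"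
    and x: "summable (\<lambda>j. norm (x j) powr r)"
    and u: "\<And>n. summable (\<lambda>j. norm (u n j) powr r)"
    and null: "\<And>j. (\<lambda>n. u n j) \<longlonglongrightarrow> 0"
    and lim: "(\<lambda>n. power_sum r (u n)) \<longlonglongrightarrow> a"
  shows "(\<lambda>n. power_sum r (x + u n)) \<longlonglongrightarrow> power_sum r x + a"
proof -
  obtain M where M: "\<And>n. power_sum r (u n) \<le> M"
    using convergent_imp_Bseq[OF convergentI[OF lim]] unfolding Bseq_def
    by (metis abs_ge_self order_trans real_norm_def)
  have "(\<lambda>n. \<Sum>j. norm ((x + u n) j) powr r - norm (u n j) powr r) \<longlonglongrightarrow> (\<Sum>j. norm (x j) powr r)"
  proof (rule suminf_tendsto_almost_dominated(3)[where G="\<lambda>n j. norm (u n j) powr r"])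
    fix \<epsilon> :: real assume "0 < \<epsilon>"
    then obtain C where "0 \<le> C" "\<And>x y :: 'k.
        \<bar>norm (x + y) powr r - norm y powr r\<bar> \<le> \<epsilon> * norm y powr r + C * norm x powr r"
      using norm_powr_perturbation[OF r] by metis
    then have "\<bar>norm ((x + u n) j) powr r - norm (u n j) powr r\<bar>
        \<le> \<epsilon> * norm (u n j) powr r + C * norm (x j) powr r" for n j
      by simp
    then show "\<exists>k. summable k \<and> (\<forall>n j. \<bar>norm ((x + u n) j) powr r - norm (u n j) powr r\<bar>
        \<le> \<epsilon> * norm (u n j) powr r + k j)"
      using summable_mult[OF x, of C] by blast
  next
    show "(\<lambda>n. norm ((x + u n) j) powr r - norm (u n j) powr r) \<longlonglongrightarrow> norm (x j) powr r" for j
    proof -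
      have "(\<lambda>n. norm (x j + u n j) powr r - norm (u n j) powr r)
          \<longlonglongrightarrow> norm (x j + 0) powr r - norm (0::'k) powr r"
        using r by (intro tendsto_diff tendsto_powr' tendsto_norm tendsto_add null tendsto_const) auto
      then show ?thesis by simp
    qed
    show "(\<Sum>j. norm (u n j) powr r) \<le> M" for n
      using M[of n] by (simp add: power_sum_def)
  qed (use u in auto)
  then have "(\<lambda>n. power_sum r (x + u n) - power_sum r (u n)) \<longlonglongrightarrow> power_sum r x"
    unfolding power_sum_def using suminf_diff[OF summable_norm_powr_add(1)[OF r x u] u] by simp
  from tendsto_add[OF this lim] show ?thesis by simp
qed

section \<open>Sums of a coordinatewise null sequence in a mixed-norm space\<close>

text \<open>\<open>mixed r (s / r)\<close> is \<open>\<ell>\<^sub>s(\<ell>\<^sub>r)\<close>, and \<open>energy r (s / r)\<close> is the \<open>s\<close>-th power of its quasi-norm.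
  Powers of quasi-norms are used because the limits below are additive in them.\<close>

definition mixed :: "real \<Rightarrow> real \<Rightarrow> (nat \<Rightarrow> nat \<Rightarrow> 'k::real_normed_field) set" where
  "mixed r t = {x. (\<forall>i. summable (\<lambda>j. norm (x i j) powr r)) \<and> summable (\<lambda>i. power_sum r (x i) powr t)}"

definition energy :: "real \<Rightarrow> real \<Rightarrow> (nat \<Rightarrow> nat \<Rightarrow> 'k::real_normed_field) \<Rightarrow> real" where
  "energy r t x = (\<Sum>i. power_sum r (x i) powr t)"

lemma mixed_add:
  assumes "0 < r" "0 < t" "x \<in> mixed r t" "y \<in> mixed r t"
  shows "x + y \<in> mixed r t"
proof -
  have sm: "summable (\<lambda>j. norm (x i j) powr r)" "summable (\<lambda>j. norm (y i j) powr r)" for i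
    using assms by (auto simp: mixed_def)
  note add = summable_norm_powr_add[OF assms(1) sm]
  have "summable (\<lambda>i. power_sum r ((x + y) i) powr t)"
  proof (rule summable_add_powr(1)[OF \<open>0 < t\<close>,
        where a="\<lambda>i. 2 powr r * power_sum r (x i)" and b="\<lambda>i. 2 powr r * power_sum r (y i)"])
    show "power_sum r ((x + y) i) \<le> 2 powr r * power_sum r (x i) + 2 powr r * power_sum r (y i)" for i
      using add(2)[of i] by (simp add: algebra_simps)
    show "0 \<le> power_sum r ((x + y) i)" for i
      using add(1)[of i] by (intro power_sum_nonneg) simp
  qed (use assms sm in \<open>auto simp: mixed_def powr_mult power_sum_nonneg intro!: summable_mult\<close>)
  then show ?thesis using add(1) by (simp add: mixed_def)
qed

text \<open>The numbers \<open>\<alpha> i\<close> describe the part of the sequence that stays in row \<open>i\<close>, where it moves off along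
  the inner index; the difference between \<open>L\<close> and the energy of this profile is carried by the part
  that escapes along the outer index.\<close>

locale coordinatewise_null =
  fixes r t :: real and u :: "nat \<Rightarrow> nat \<Rightarrow> nat \<Rightarrow> 'k::real_normed_field"
    and \<alpha> :: "nat \<Rightarrow> real" and L :: real
  assumes r: "0 < r" and t: "0 < t"
    and mem: "\<And>n. u n \<in> mixed r t"
    and null: "\<And>i j. (\<lambda>n. u n i j) \<longlonglongrightarrow> 0"
    and rows: "\<And>i. (\<lambda>n. power_sum r (u n i)) \<longlonglongrightarrow> \<alpha> i"
    and energies: "(\<lambda>n. energy r t (u n)) \<longlonglongrightarrow> L"
begin

lemma summable_row: "summable (\<lambda>j. norm (u n i j) powr r)"
  using mem by (simp add: mixed_def)

lemma summable_rows: "summable (\<lambda>i. power_sum r (u n i) powr t)"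
  using mem by (simp add: mixed_def)

lemma row_nonneg: "0 \<le> power_sum r (u n i)"
  by (rule power_sum_nonneg[OF summable_row])

lemma profile_nonneg: "0 \<le> \<alpha> i"
  using LIMSEQ_le_const[OF rows] row_nonneg by auto

lemma profile_powr: "(\<lambda>n. power_sum r (u n i) powr t) \<longlonglongrightarrow> \<alpha> i powr t"
  using t row_nonneg by (intro tendsto_powr' rows tendsto_const) auto

lemma profile_sum_le: "(\<Sum>i<m. \<alpha> i powr t) \<le> L"
proof (rule LIMSEQ_le[OF _ energies])
  show "(\<lambda>n. \<Sum>i<m. power_sum r (u n i) powr t) \<longlonglongrightarrow> (\<Sum>i<m. \<alpha> i powr t)"
    by (intro tendsto_sum profile_powr)
  show "\<exists>N. \<forall>n\<ge>N. (\<Sum>i<m. power_sum r (u n i) powr t) \<le> energy r t (u n)"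
    unfolding energy_def by (auto intro!: sum_le_suminf summable_rows)
qed

lemma profile_summable: "summable (\<lambda>i. \<alpha> i powr t)"
  by (rule summableI_nonneg_bounded[OF _ profile_sum_le]) auto

definition profile_mass :: real where "profile_mass = (\<Sum>i. \<alpha> i powr t)"

definition escaping_mass :: real where "escaping_mass = L - profile_mass"

lemma profile_mass_nonneg: "0 \<le> profile_mass"
  unfolding profile_mass_def by (intro suminf_nonneg profile_summable) auto

lemma escaping_mass_nonneg: "0 \<le> escaping_mass"
  unfolding escaping_mass_def profile_mass_def
  using suminf_le_const[OF profile_summable profile_sum_le] by simp

text \<open>\<open>\<Phi> c x\<close> is the energy that \<open>x\<close> has after \<open>c\<close> further vectors with row sums \<open>\<alpha>\<close>, disjoint from
  \<open>x\<close> and from each other, have been added to it.\<close>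

definition \<Phi> :: "real \<Rightarrow> (nat \<Rightarrow> nat \<Rightarrow> 'k) \<Rightarrow> real" where
  "\<Phi> c x = (\<Sum>i. (power_sum r (x i) + c * \<alpha> i) powr t)"

text \<open>The factor \<open>b\<close> is there for the dominating sequence in the proof of \<open>\<Phi>_add_tendsto\<close>, in which the
  row sums of \<open>x\<close> carry a constant.\<close>

lemma \<Phi>_summable:
  assumes "x \<in> mixed r t" "0 \<le> b" "0 \<le> c"
  shows "summable (\<lambda>i. (b * power_sum r (x i) + c * \<alpha> i) powr t)"
proof (rule summable_add_powr(1)[OF t, where a="\<lambda>i. b * power_sum r (x i)" and b="\<lambda>i. c * \<alpha> i"])
  have x: "0 \<le> power_sum r (x i)" for i using assms by (auto simp: mixed_def intro: power_sum_nonneg)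
  then show "0 \<le> b * power_sum r (x i)" "0 \<le> c * \<alpha> i" "0 \<le> b * power_sum r (x i) + c * \<alpha> i" for i
    using assms profile_nonneg by auto
  show "summable (\<lambda>i. (b * power_sum r (x i)) powr t)" "summable (\<lambda>i. (c * \<alpha> i) powr t)"
    using assms x profile_nonneg profile_summable
    by (auto simp: mixed_def powr_mult intro!: summable_mult)
qed auto

text \<open>In each row, the Brezis--Lieb lemma says that \<open>u n\<close> adds \<open>\<alpha> i\<close> to the row sum in the limit.
  Across the rows the same principle is applied to the \<open>t\<close>-th powers of the row sums: comparing them
  with those of \<open>u n\<close> alone leaves an almost dominated series, so the limit may be taken termwise.
  Subtracting the energy of \<open>u n\<close> costs \<open>L\<close> in the limit, but the termwise limit accounts only for
  the profile mass; the difference is the escaping mass.\<close>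

lemma \<Phi>_add_tendsto:
  assumes x: "x \<in> mixed r t" and c: "0 \<le> c"
  shows "(\<lambda>n. \<Phi> c (x + u n)) \<longlonglongrightarrow> \<Phi> (c + 1) x + escaping_mass"
proof -
  have xs: "summable (\<lambda>j. norm (x i j) powr r)" for i using x by (simp add: mixed_def)
  have xnn: "0 \<le> power_sum r (x i)" for i by (rule power_sum_nonneg[OF xs])
  have xun: "x + u n \<in> mixed r t" for n by (rule mixed_add[OF r t x mem])
  have xunn: "0 \<le> power_sum r (x i + u n i)" for n i
    using xun[of n] by (auto simp: mixed_def intro!: power_sum_nonneg)
  obtain M where M: "\<And>n. energy r t (u n) \<le> M"
    using convergent_imp_Bseq[OF convergentI[OF energies]] unfolding Bseq_def
    by (metis abs_ge_self order_trans real_norm_def)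
  let ?\<Delta> = "\<lambda>n i. (power_sum r (x i + u n i) + c * \<alpha> i) powr t - power_sum r (u n i) powr t"
  let ?H = "\<lambda>i. (power_sum r (x i) + (c + 1) * \<alpha> i) powr t - \<alpha> i powr t"
  have "(\<lambda>n. suminf (?\<Delta> n)) \<longlonglongrightarrow> suminf ?H"
  proof (rule suminf_tendsto_almost_dominated(3)[where G="\<lambda>n i. power_sum r (u n i) powr t" and M=M])
    fix \<epsilon> :: real assume "0 < \<epsilon>"
    then obtain \<delta> C where \<delta>: "0 < \<delta>" "0 \<le> C"
      "\<And>b b' z. \<lbrakk>0 \<le> b; 0 \<le> b'; 0 \<le> z; \<bar>b' - b\<bar> \<le> \<delta> * b + z\<rbrakk>
         \<Longrightarrow> \<bar>b' powr t - b powr t\<bar> \<le> \<epsilon> * b powr t + C * z powr t"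
      using powr_perturbation[OF t] by metis
    obtain C' where C': "0 \<le> C'"
      "\<And>x y :: nat \<Rightarrow> 'k. \<lbrakk>summable (\<lambda>j. norm (x j) powr r); summable (\<lambda>j. norm (y j) powr r)\<rbrakk>
        \<Longrightarrow> \<bar>power_sum r (x + y) - power_sum r y\<bar> \<le> \<delta> * power_sum r y + C' * power_sum r x"
      using power_sum_perturbation[OF r \<delta>(1)] by metis
    have "\<bar>?\<Delta> n i\<bar> \<le> \<epsilon> * power_sum r (u n i) powr t + C * (C' * power_sum r (x i) + c * \<alpha> i) powr t" for n i
    proof (rule \<delta>(3))
      show "\<bar>power_sum r (x i + u n i) + c * \<alpha> i - power_sum r (u n i)\<bar>
          \<le> \<delta> * power_sum r (u n i) + (C' * power_sum r (x i) + c * \<alpha> i)"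
        using C'(2)[OF xs summable_row, of i n i] mult_nonneg_nonneg[OF c profile_nonneg, of i]
        by linarith
    qed (use c C' xnn xunn profile_nonneg row_nonneg in auto)
    moreover have "summable (\<lambda>i. C * (C' * power_sum r (x i) + c * \<alpha> i) powr t)"
      by (intro summable_mult \<Phi>_summable x c C')
    ultimately show "\<exists>k. summable k \<and> (\<forall>n i. \<bar>?\<Delta> n i\<bar> \<le> \<epsilon> * power_sum r (u n i) powr t + k i)"
      by blast
  next
    fix i
    have "(\<lambda>n. power_sum r (x i + u n i) + c * \<alpha> i) \<longlonglongrightarrow> power_sum r (x i) + (c + 1) * \<alpha> i"
      using tendsto_add[OF brezis_lieb[OF r xs summable_row null rows] tendsto_const[of "c * \<alpha> i"]]
      by (simp add: algebra_simps)
    then show "(\<lambda>n. ?\<Delta> n i) \<longlonglongrightarrow> ?H i"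
      using t c xunn profile_nonneg
      by (intro tendsto_diff profile_powr tendsto_powr' tendsto_const) auto
  qed (use M summable_rows in \<open>auto simp: energy_def\<close>)
  moreover have "suminf (?\<Delta> n) = \<Phi> c (x + u n) - energy r t (u n)" for n
    using suminf_diff[OF \<Phi>_summable[OF xun[of n], of 1 c] summable_rows[of n]] c
    by (simp add: \<Phi>_def energy_def)
  moreover have "suminf ?H = \<Phi> (c + 1) x - profile_mass"
    using suminf_diff[OF \<Phi>_summable[OF x, of 1 "c + 1"] profile_summable] c
    by (simp add: \<Phi>_def profile_mass_def)
  ultimately have "(\<lambda>n. \<Phi> c (x + u n) - energy r t (u n)) \<longlonglongrightarrow> \<Phi> (c + 1) x - profile_mass"
    by simp
  from tendsto_add[OF this energies] show ?thesis
    by (simp add: escaping_mass_def algebra_simps)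
qed

text \<open>Iterating the limit: adding the vectors one at a time, each far enough out, replaces \<open>\<Phi> N\<close> by
  \<open>\<Phi> (N + 1)\<close> and contributes one escaping mass.
  The starting vector \<open>x\<close> has to be arbitrary, since the first summand is absorbed into it.\<close>

lemma sum_energy_approx:
  assumes "x \<in> mixed r t" "0 < \<epsilon>"
  shows "\<exists>A. finite A \<and> card A = N \<and> A \<subseteq> {m..} \<and>
    \<bar>energy r t (x + sum u A) - (\<Phi> N x + N * escaping_mass)\<bar> < \<epsilon>"
  using assms
proof (induction N arbitrary: x \<epsilon> m)
  case 0
  then show ?case by (intro exI[of _ "{}"]) (simp add: \<Phi>_def energy_def)
next
  case (Suc N)
  have "\<forall>\<^sub>F n in sequentially. dist (\<Phi> N (x + u n)) (\<Phi> (real N + 1) x + escaping_mass) < \<epsilon> / 2"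
    using Suc.prems by (intro tendstoD \<Phi>_add_tendsto) auto
  then obtain n where n: "m \<le> n"
    "\<bar>\<Phi> N (x + u n) - (\<Phi> (real N + 1) x + escaping_mass)\<bar> < \<epsilon> / 2"
    by (metis (mono_tags, lifting) dist_real_def eventually_sequentially nle_le)
  obtain A where A: "finite A" "card A = N" "A \<subseteq> {Suc n..}"
    "\<bar>energy r t (x + u n + sum u A) - (\<Phi> N (x + u n) + N * escaping_mass)\<bar> < \<epsilon> / 2"
    using Suc.IH[OF mixed_add[OF r t Suc.prems(1) mem] half_gt_zero[OF Suc.prems(2)]] by blast
  have "n \<notin> A" using A by auto
  then have sum: "x + sum u (insert n A) = x + u n + sum u A"
    using A by (simp add: add.assoc)
  have "real (Suc N) * escaping_mass = N * escaping_mass + escaping_mass"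
    by (simp add: algebra_simps)
  then have approx: "\<bar>energy r t (x + sum u (insert n A)) - (\<Phi> (Suc N) x + Suc N * escaping_mass)\<bar> < \<epsilon>"
    using n(2) A(4) unfolding sum of_nat_Suc by (simp only: add.commute[of 1])
  show ?case
  proof (intro exI[of _ "insert n A"] conjI)
    show "insert n A \<subseteq> {m..}" using A(3) n(1) by fastforce
    show "card (insert n A) = Suc N" using A(1,2) \<open>n \<notin> A\<close> by simp
  qed (use A(1) approx in blast)+
qed

text \<open>The profile contributes the growth of \<open>\<ell>\<^sub>r\<close> and the escaping part that of \<open>\<ell>\<^sub>s\<close>.\<close>

lemma sum_energy_growth:
  assumes "0 < \<epsilon>"
  obtains A where "finite A" "card A = N"
    "\<bar>energy r t (sum u A) - (N powr t * profile_mass + N * escaping_mass)\<bar> < \<epsilon>"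
proof -
  have zero: "(0 :: nat \<Rightarrow> nat \<Rightarrow> 'k) \<in> mixed r t"
    by (simp add: mixed_def power_sum_def)
  have "(real N * \<alpha> i) powr t = N powr t * \<alpha> i powr t" for i
    using profile_nonneg by (simp add: powr_mult)
  then have "\<Phi> N 0 = N powr t * profile_mass"
    using profile_summable by (simp add: \<Phi>_def power_sum_def profile_mass_def suminf_mult)
  then show thesis
    using sum_energy_approx[OF zero assms, of N 0] that by auto
qed

end

lemma powr_growth_imp_le:
  fixes a b c C :: real
  assumes "0 < c" and le: "\<And>N. (1::nat) \<le> N \<Longrightarrow> c * N powr a \<le> C * N powr b"
  shows "a \<le> b"
proof (rule ccontr)
  assume "\<not> a \<le> b"
  have "filterlim (\<lambda>N::nat. real N powr (a - b)) at_top sequentially"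
    using \<open>\<not> a \<le> b\<close> by real_asymp
  then have "\<forall>\<^sub>F N in sequentially. C / c + 1 \<le> real N powr (a - b)"
    by (simp add: filterlim_at_top)
  then have "\<forall>\<^sub>F N in sequentially. C / c + 1 \<le> real N powr (a - b) \<and> 1 \<le> N"
    by (intro eventually_conj) (auto simp: eventually_ge_at_top)
  then obtain N :: nat where N: "C / c + 1 \<le> real N powr (a - b)" "1 \<le> N"
    by (auto simp: eventually_sequentially)
  have "c * real N powr a / N powr b \<le> C"
    using le[OF N(2)] N(2) by (simp add: divide_le_eq)
  then have "real N powr (a - b) \<le> C / c"
    using assms(1) by (simp add: powr_diff field_simps)
  with N(1) show False by simp
qed

text \<open>The sum of two power functions with nonnegative coefficients grows like the larger of the two
  that are present.\<close>

lemma powr_sum_growth_exponent: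
  fixes P Q c C t \<sigma> :: real
  assumes "0 \<le> P" "0 \<le> Q" "0 < c"
    and lower: "\<And>N. (1::nat) \<le> N \<Longrightarrow> c * real N powr \<sigma> \<le> N powr t * P + N * Q"
    and upper: "\<And>N. (1::nat) \<le> N \<Longrightarrow> N powr t * P + N * Q \<le> C * N powr \<sigma>"
  shows "\<sigma> = t \<or> \<sigma> = 1"
proof -
  have t: "t \<le> \<sigma>" if "0 < P"
  proof (rule powr_growth_imp_le[OF that, of _ C])
    show "P * real N powr t \<le> C * real N powr \<sigma>" if "1 \<le> N" for N :: nat
    proof -
      have "0 \<le> real N * Q" using assms(2) by simp
      then show ?thesis using upper[OF that] by (simp add: mult.commute[of P])
    qed
  qed
  have one: "1 \<le> \<sigma>" if "0 < Q"
  proof (rule powr_growth_imp_le[OF that, of _ C])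
    show "Q * real N powr 1 \<le> C * real N powr \<sigma>" if "1 \<le> N" for N :: nat
    proof -
      have "0 \<le> real N powr t * P" using assms(1) by simp
      then show ?thesis using upper[OF that] by (simp add: mult.commute[of Q])
    qed
  qed
  have le: "\<sigma> \<le> a" if a: "0 < P \<Longrightarrow> t \<le> a" "0 < Q \<Longrightarrow> 1 \<le> a" for a
  proof (rule powr_growth_imp_le[OF \<open>0 < c\<close>, of _ "P + Q"])
    fix N :: nat assume N: "1 \<le> N"
    have "N powr t * P \<le> N powr a * P"
      using a(1) assms(1) N by (cases "P = 0") (auto intro!: mult_right_mono powr_mono)
    moreover have "N * Q \<le> N powr a * Q"
      using powr_mono[of 1 a "real N"] a(2) assms(2) N by (cases "Q = 0") (auto intro!: mult_right_mono)
    ultimately show "c * real N powr \<sigma> \<le> (P + Q) * real N powr a"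
      using lower[OF N] by (simp add: algebra_simps)
  qed
  have "0 < P \<or> 0 < Q"
    using lower[of 1] assms by (cases "P = 0") auto
  moreover have "\<sigma> \<le> max t 1" by (rule le) auto
  ultimately show ?thesis using t one le[of t] le[of 1] assms(1,2) by linarith
qed

lemma (in coordinatewise_null) growth_exponent:
  assumes "0 < c"
    and bounds: "\<And>A. finite A \<Longrightarrow> A \<noteq> {} \<Longrightarrow> c * card A powr \<sigma> \<le> energy r t (sum u A)"
      "\<And>A. finite A \<Longrightarrow> A \<noteq> {} \<Longrightarrow> energy r t (sum u A) \<le> C * card A powr \<sigma>"
  shows "\<sigma> = t \<or> \<sigma> = 1"
proof (rule powr_sum_growth_exponent[OF profile_mass_nonneg escaping_mass_nonneg \<open>0 < c\<close>])
  fix N :: nat assume N: "1 \<le> N"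
  let ?F = "N powr t * profile_mass + N * escaping_mass"
  show "c * N powr \<sigma> \<le> ?F"
  proof (rule field_le_epsilon)
    fix e :: real assume "0 < e"
    then obtain A where A: "finite A" "card A = N" "\<bar>energy r t (sum u A) - ?F\<bar> < e"
      by (rule sum_energy_growth)
    then have "A \<noteq> {}" using N by auto
    then show "c * N powr \<sigma> \<le> ?F + e" using bounds(1)[of A] A by (auto simp: abs_less_iff)
  qed
  show "?F \<le> C * N powr \<sigma>"
  proof (rule field_le_epsilon)
    fix e :: real assume "0 < e"
    then obtain A where A: "finite A" "card A = N" "\<bar>energy r t (sum u A) - ?F\<bar> < e"
      by (rule sum_energy_growth)
    then have "A \<noteq> {}" using N by auto
    then show "?F \<le> C * N powr \<sigma> + e" using bounds(2)[of A] A by (auto simp: abs_less_iff)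
  qed
qed

section \<open>Quasi-normed spaces and their embeddings\<close>

locale quasi_normed =
  fixes X :: "('k::real_normed_field, 'v::ab_group_add) qn_space" and K :: real
  assumes K_ge_1: "1 \<le> K"
    and zero_mem: "0 \<in> carrier X"
    and add_mem: "\<lbrakk>x \<in> carrier X; y \<in> carrier X\<rbrakk> \<Longrightarrow> x + y \<in> carrier X"
    and smult_mem: "x \<in> carrier X \<Longrightarrow> smult X c x \<in> carrier X"
    and smult_minus_one: "x \<in> carrier X \<Longrightarrow> smult X (-1) x = - x"
    and qnorm_nonneg: "x \<in> carrier X \<Longrightarrow> 0 \<le> qnorm X x"
    and qnorm_eq_0_iff: "x \<in> carrier X \<Longrightarrow> qnorm X x = 0 \<longleftrightarrow> x = 0"
    and qnorm_smult: "x \<in> carrier X \<Longrightarrow> qnorm X (smult X c x) = norm c * qnorm X x"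
    and qnorm_add: "\<lbrakk>x \<in> carrier X; y \<in> carrier X\<rbrakk> \<Longrightarrow> qnorm X (x + y) \<le> K * (qnorm X x + qnorm X y)"
begin

lemma uminus_mem: "x \<in> carrier X \<Longrightarrow> - x \<in> carrier X"
  using smult_mem[of x "-1"] by (simp add: smult_minus_one)

lemma diff_mem: "\<lbrakk>x \<in> carrier X; y \<in> carrier X\<rbrakk> \<Longrightarrow> x - y \<in> carrier X"
  using add_mem[of x "- y"] uminus_mem[of y] by simp

lemma sum_mem: "(\<And>n. n \<in> A \<Longrightarrow> f n \<in> carrier X) \<Longrightarrow> sum f A \<in> carrier X"
  by (induction A rule: infinite_finite_induct) (auto simp: zero_mem add_mem)

lemma qnorm_0 [simp]: "qnorm X 0 = 0"
  using qnorm_eq_0_iff[OF zero_mem] by simp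

text \<open>Balls of a quasi-norm need not be open, so open sets are produced as sets of inner points.\<close>

definition inner_points :: "('v \<Rightarrow> bool) \<Rightarrow> 'v set" where
  "inner_points P = {y \<in> carrier X. \<exists>e>0. \<forall>z\<in>carrier X. qnorm X (z - y) < e \<longrightarrow> P z}"

lemma inner_pointsI:
  "\<lbrakk>y \<in> carrier X; 0 < e; \<And>z. \<lbrakk>z \<in> carrier X; qnorm X (z - y) < e\<rbrakk> \<Longrightarrow> P z\<rbrakk> \<Longrightarrow> y \<in> inner_points P"
  by (auto simp: inner_points_def)

lemma inner_points_imp: "y \<in> inner_points P \<Longrightarrow> P y"
  by (auto simp: inner_points_def)

text \<open>The quasi-triangle inequality puts the ball of radius \<open>e / (2 * K)\<close> around a nearby point inside
  the ball of radius \<open>e\<close>.\<close>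

lemma openin_inner_points: "openin (qn_topology X) (inner_points P)"
  unfolding openin_qn_topology
proof (intro conjI ballI)
  fix y assume "y \<in> inner_points P"
  then obtain e where y: "y \<in> carrier X" and e: "e > 0"
    "\<And>z. z \<in> carrier X \<Longrightarrow> qnorm X (z - y) < e \<Longrightarrow> P z" by (auto simp: inner_points_def)
  define d where "d = e / (2 * K)"
  have d: "d > 0" "K * (d + d) = e" using e K_ge_1 by (auto simp: d_def)
  show "\<exists>e>0. \<forall>y'\<in>carrier X. qnorm X (y' - y) < e \<longrightarrow> y' \<in> inner_points P"
  proof (intro exI[of _ d] conjI ballI impI)
    fix y' assume y': "y' \<in> carrier X" "qnorm X (y' - y) < d"
    show "y' \<in> inner_points P"
    proof (rule inner_pointsI[OF y'(1) d(1)])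
      fix z assume z: "z \<in> carrier X" "qnorm X (z - y') < d"
      have "qnorm X (z - y) = qnorm X ((z - y') + (y' - y))" by simp
      also have "\<dots> \<le> K * (qnorm X (z - y') + qnorm X (y' - y))"
        using y y' z by (intro qnorm_add diff_mem)
      also have "\<dots> < K * (d + d)"
        using y' z K_ge_1 by (intro mult_strict_left_mono) auto
      finally show "P z" using e(2) z d by simp
    qed
  qed (use d in auto)
qed (auto simp: inner_points_def)

end

text \<open>Continuity at \<open>0\<close> becomes a linear bound by rescaling.\<close>

lemma homogeneous_bound:
  assumes X: "quasi_normed X K"
    and hom: "\<And>c x. x \<in> carrier X \<Longrightarrow> f (smult X c x) = norm c * f x"
      "\<And>c x. x \<in> carrier X \<Longrightarrow> g (smult X c x) = norm c * g x"
    and nonneg: "\<And>x. x \<in> carrier X \<Longrightarrow> 0 \<le> f x"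
    and pos: "0 < d" "0 < e"
    and ball: "\<And>x. x \<in> carrier X \<Longrightarrow> f x < d \<Longrightarrow> g x < e"
    and x: "x \<in> carrier X"
  shows "g x \<le> 2 * e / d * f x"
proof -
  interpret quasi_normed X K by fact
  have scaled: "c * g x < e" if "0 \<le> c" "c * f x < d" for c :: real
    using ball[OF smult_mem[OF x, of "of_real c"]] that x hom by simp
  show ?thesis
  proof (cases "f x = 0")
    case True
    \<comment> \<open>All multiples of \<open>x\<close> stay in the ball, so \<open>g\<close> cannot be positive at \<open>x\<close>.\<close>
    have "g x \<le> 0"
    proof (rule ccontr)
      assume "\<not> g x \<le> 0"
      then show False using scaled[of "e / g x"] True pos by simp
    qed
    then show ?thesis using True by simp
  next
    case False
    then have "0 < f x" using nonneg[OF x] by simp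
    then have "d / (2 * f x) * g x < e" using pos by (intro scaled) (auto simp: field_simps)
    then show ?thesis using pos \<open>0 < f x\<close> by (simp add: field_simps)
  qed
qed

lemma embedding_imp_equivalent_norms:
  assumes X: "quasi_normed X K" and Y: "quasi_normed Y K'"
    and T: "linear_map_between X Y T" "embedding_map (qn_topology X) (qn_topology Y) T"
  obtains c C where "0 < c" "0 < C"
    "\<And>x. x \<in> carrier X \<Longrightarrow> c * qnorm X x \<le> qnorm Y (T x)"
    "\<And>x. x \<in> carrier X \<Longrightarrow> qnorm Y (T x) \<le> C * qnorm X x"
proof -
  interpret X: quasi_normed X K by fact
  interpret Y: quasi_normed Y K' by fact
  have mem: "T x \<in> carrier Y" if "x \<in> carrier X" for x
    using T(1) that by (auto simp: linear_map_between_def)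
  have homT: "qnorm Y (T (smult X c x)) = norm c * qnorm Y (T x)" if "x \<in> carrier X" for c x
    using T(1) that mem Y.qnorm_smult by (auto simp: linear_map_between_def)
  have T0: "T 0 = 0"
  proof -
    have "T (0 + 0) = T 0 + T 0"
      using T(1) X.zero_mem unfolding linear_map_between_def by blast
    then show ?thesis by simp
  qed
  have hom: "homeomorphic_map (qn_topology X) (subtopology (qn_topology Y) (T ` carrier X)) T"
    using T(2) by (simp add: embedding_map_def topspace_qn_topology)
  then have cont: "continuous_map (qn_topology X) (qn_topology Y) T"
    using continuous_map_in_subtopology homeomorphic_imp_continuous_map by blast
  have inj: "inj_on T (carrier X)"
    using homeomorphic_imp_injective_map[OF hom] by (simp add: topspace_qn_topology)
  have op: "open_map (qn_topology X) (subtopology (qn_topology Y) (T ` carrier X)) T"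
    by (rule homeomorphic_imp_open_map[OF hom])
  have "\<exists>d>0. \<forall>x\<in>carrier X. qnorm X x < d \<longrightarrow> qnorm Y (T x) < 1"
  proof -
    let ?V = "Y.inner_points (\<lambda>y. qnorm Y y < 1)"
    have "openin (qn_topology X) {x \<in> carrier X. T x \<in> ?V}"
      using openin_continuous_map_preimage[OF cont Y.openin_inner_points] by (simp add: topspace_qn_topology)
    moreover have "0 \<in> {x \<in> carrier X. T x \<in> ?V}"
      using X.zero_mem Y.inner_pointsI[OF Y.zero_mem zero_less_one] by (simp add: T0)
    ultimately obtain d where d: "d > 0"
      "\<And>x. x \<in> carrier X \<Longrightarrow> qnorm X (x - 0) < d \<Longrightarrow> T x \<in> ?V"
      unfolding openin_qn_topology by blast
    show ?thesis
      using d Y.inner_points_imp by (intro exI[of _ d]) auto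
  qed
  then obtain d where d: "d > 0" "\<And>x. x \<in> carrier X \<Longrightarrow> qnorm X x < d \<Longrightarrow> qnorm Y (T x) < 1"
    by blast
  have "\<exists>e>0. \<forall>x\<in>carrier X. qnorm Y (T x) < e \<longrightarrow> qnorm X x < 1"
  proof -
    let ?V = "X.inner_points (\<lambda>x. qnorm X x < 1)"
    have Vsub: "?V \<subseteq> carrier X" by (auto simp: X.inner_points_def)
    have "openin (subtopology (qn_topology Y) (T ` carrier X)) (T ` ?V)"
      using op X.openin_inner_points unfolding open_map_def by blast
    then obtain W where W: "openin (qn_topology Y) W" "T ` ?V = W \<inter> T ` carrier X"
      unfolding openin_subtopology by blast
    have "0 \<in> ?V" by (rule X.inner_pointsI[OF X.zero_mem zero_less_one]) simp
    then have "T 0 \<in> W" using W(2) by blast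
    then have "0 \<in> W" by (simp add: T0)
    then obtain e where e: "e > 0" "\<And>y. y \<in> carrier Y \<Longrightarrow> qnorm Y (y - 0) < e \<Longrightarrow> y \<in> W"
      using W(1) unfolding openin_qn_topology by blast
    have "qnorm X x < 1" if x: "x \<in> carrier X" "qnorm Y (T x) < e" for x
    proof -
      have "T x \<in> W" using e(2)[OF mem[OF x(1)]] x(2) by simp
      then have "T x \<in> T ` ?V" using x(1) W(2) by blast
      then have "x \<in> ?V" using inj_on_image_mem_iff[OF inj x(1) Vsub] by blast
      then show ?thesis by (rule X.inner_points_imp)
    qed
    then show ?thesis using e(1) by blast
  qed
  then obtain e where e: "e > 0" "\<And>x. x \<in> carrier X \<Longrightarrow> qnorm Y (T x) < e \<Longrightarrow> qnorm X x < 1"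
    by blast
  show thesis
  proof (rule that[of "e / 2" "2 / d"])
    fix x assume x: "x \<in> carrier X"
    have "qnorm X x \<le> 2 * 1 / e * qnorm Y (T x)"
      by (rule homogeneous_bound[OF X, where f="\<lambda>x. qnorm Y (T x)"])
        (use x e homT mem in \<open>auto simp: Y.qnorm_nonneg X.qnorm_smult\<close>)
    then show "e / 2 * qnorm X x \<le> qnorm Y (T x)" using e(1) by (simp add: field_simps)
    have "qnorm Y (T x) \<le> 2 * 1 / d * qnorm X x"
      by (rule homogeneous_bound[OF X, where f="qnorm X" and g="\<lambda>x. qnorm Y (T x)"])
        (use x d homT mem in \<open>auto simp: X.qnorm_nonneg X.qnorm_smult\<close>)
    then show "qnorm Y (T x) \<le> 2 / d * qnorm X x" by simp
  qed (use d e in auto)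
qed

text \<open>An isometry maps an open set \<open>U\<close> onto the trace of an open set on its range: take the inner points
  of the set of vectors that are not images of points outside \<open>U\<close>.\<close>

lemma isometry_imp_embeds:
  assumes X: "quasi_normed X K" and Y: "quasi_normed Y K'"
    and T: "linear_map_between X Y T"
    and iso: "\<And>x. x \<in> carrier X \<Longrightarrow> qnorm Y (T x) = qnorm X x"
    and closed: "closedin (qn_topology Y) (T ` carrier X)"
  shows "isomorphically_embeds X Y"
proof -
  interpret X: quasi_normed X K by fact
  interpret Y: quasi_normed Y K' by fact
  have mem: "T x \<in> carrier Y" if "x \<in> carrier X" for x
    using T that by (auto simp: linear_map_between_def)
  have diff: "T (x - y) = T x - T y" if "x \<in> carrier X" "y \<in> carrier X" for x y
  proof -
    have "T ((x - y) + y) = T (x - y) + T y"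
      using T that X.diff_mem unfolding linear_map_between_def by blast
    then show ?thesis by (simp add: algebra_simps)
  qed
  have dist: "qnorm Y (T x - T y) = qnorm X (x - y)" if "x \<in> carrier X" "y \<in> carrier X" for x y
    using iso[OF X.diff_mem[OF that]] diff[OF that] by simp
  have inj: "inj_on T (carrier X)"
  proof (rule inj_onI)
    fix x y assume xy: "x \<in> carrier X" "y \<in> carrier X" "T x = T y"
    then have "qnorm X (x - y) = 0" using dist[of x y] by simp
    then show "x = y" using X.qnorm_eq_0_iff[OF X.diff_mem] xy by auto
  qed
  let ?S = "subtopology (qn_topology Y) (T ` carrier X)"
  have top: "topspace ?S = T ` carrier X"
    using mem by (auto simp: topspace_qn_topology)
  have "homeomorphic_map (qn_topology X) ?S T"
  proof (rule bijective_open_imp_homeomorphic_map)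
    show "continuous_map (qn_topology X) ?S T"
      unfolding continuous_map_in_subtopology
      unfolding continuous_map topspace_qn_topology
    proof (intro conjI allI impI)
      fix U assume U: "openin (qn_topology Y) U"
      show "openin (qn_topology X) {x \<in> carrier X. T x \<in> U}"
        unfolding openin_qn_topology
      proof (intro conjI ballI)
        fix x assume x: "x \<in> {x \<in> carrier X. T x \<in> U}"
        then obtain e where "e > 0" "\<forall>y\<in>carrier Y. qnorm Y (y - T x) < e \<longrightarrow> y \<in> U"
          using U unfolding openin_qn_topology by blast
        then show "\<exists>e>0. \<forall>y\<in>carrier X. qnorm X (y - x) < e \<longrightarrow> y \<in> {x \<in> carrier X. T x \<in> U}"
          using x mem dist by (intro exI[of _ e]) auto
      qed auto
    qed (use mem in auto)
    show "open_map (qn_topology X) ?S T"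
      unfolding open_map_def
    proof (intro allI impI)
      fix U assume U: "openin (qn_topology X) U"
      let ?V = "Y.inner_points (\<lambda>z. \<forall>x\<in>carrier X. z = T x \<longrightarrow> x \<in> U)"
      have Usub: "U \<subseteq> carrier X" using U by (simp add: openin_qn_topology)
      have "T x \<in> ?V" if x: "x \<in> U" for x
      proof -
        obtain e where e: "e > 0" "\<And>z. z \<in> carrier X \<Longrightarrow> qnorm X (z - x) < e \<Longrightarrow> z \<in> U"
          using U x unfolding openin_qn_topology by blast
        have xX: "x \<in> carrier X" using x Usub by blast
        show ?thesis
          by (rule Y.inner_pointsI[OF mem[OF xX] e(1)]) (use e(2) dist[OF _ xX] in auto)
      qed
      moreover have "x \<in> U" if "x \<in> carrier X" "T x \<in> ?V" for x
        using Y.inner_points_imp[OF that(2)] that(1) by blast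
      ultimately have "T ` U = ?V \<inter> T ` carrier X" using Usub by blast
      then show "openin ?S (T ` U)"
        using openin_subtopology_Int[OF Y.openin_inner_points] by simp
    qed
  qed (use inj top in \<open>auto simp: topspace_qn_topology\<close>)
  then show ?thesis
    unfolding isomorphically_embeds_def embedding_map_def using T closed
    by (auto simp: topspace_qn_topology)
qed

section \<open>Sequence spaces as quasi-normed spaces\<close>

text \<open>With the field as a space over itself, \<open>\<ell>\<^sub>p\<close> becomes an instance of \<open>ell_of\<close>, and one proof of the
  quasi-norm axioms serves both levels of \<open>\<ell>\<^sub>s(\<ell>\<^sub>r)\<close>.\<close>

definition scalars :: "('k::real_normed_field, 'k) qn_space" where
  "scalars = \<lparr>carrier = UNIV, smult = (*), qnorm = norm\<rparr>"

lemma ell_eq: "ell p = ell_of p scalars"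
  by (simp add: ell_def ell_of_def scalars_def)

lemma quasi_normed_scalars: "quasi_normed scalars 1"
  by unfold_locales (auto simp: scalars_def norm_mult norm_triangle_ineq)

lemma quasi_normed_ell_of:
  assumes "quasi_normed X K" "0 < s"
  shows "quasi_normed (ell_of s X) (2 * 2 powr (1/s) * K)"
proof -
  interpret X: quasi_normed X K by fact
  note [simp] = ell_of_def
  have add: "x + y \<in> carrier (ell_of s X) \<and>
      qnorm (ell_of s X) (x + y) \<le> 2 * 2 powr (1/s) * K * (qnorm (ell_of s X) x + qnorm (ell_of s X) y)"
    if x: "x \<in> carrier (ell_of s X)" and y: "y \<in> carrier (ell_of s X)" for x y
  proof -
    let ?a = "\<lambda>i. K * qnorm X (x i)" and ?b = "\<lambda>i. K * qnorm X (y i)"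
    let ?c = "\<lambda>i. qnorm X ((x + y) i)"
    let ?A = "\<Sum>i. qnorm X (x i) powr s" and ?B = "\<Sum>i. qnorm X (y i) powr s"
    have mem: "x i \<in> carrier X" "y i \<in> carrier X" "x i + y i \<in> carrier X" for i
      using x y X.add_mem by auto
    have sx: "summable (\<lambda>i. qnorm X (x i) powr s)" and sy: "summable (\<lambda>i. qnorm X (y i) powr s)"
      using x y by auto
    have pa: "?a i powr s = K powr s * qnorm X (x i) powr s"
      and pb: "?b i powr s = K powr s * qnorm X (y i) powr s" for i
      using X.K_ge_1 X.qnorm_nonneg mem by (auto simp: powr_mult)
    have nn: "0 \<le> ?a i" "0 \<le> ?b i" "0 \<le> ?c i" "?c i \<le> ?a i + ?b i" for i
      using X.K_ge_1 X.qnorm_nonneg mem X.qnorm_add[OF mem(1,2), of i i]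
      by (auto simp: algebra_simps)
    have sm: "summable (\<lambda>i. ?a i powr s)" "summable (\<lambda>i. ?b i powr s)"
      unfolding pa pb by (intro summable_mult sx sy)+
    note S = summable_add_powr[OF \<open>0 < s\<close> nn sm]
    have AB: "0 \<le> ?A" "0 \<le> ?B" using sx sy by (auto intro: suminf_nonneg)
    have "0 \<le> (\<Sum>i. ?c i powr s)" using S(1) by (intro suminf_nonneg) auto
    moreover have "(\<Sum>i. ?c i powr s) \<le> 2 powr s * K powr s * (?A + ?B)"
      using S(2) sx sy unfolding pa pb by (simp add: suminf_mult algebra_simps)
    ultimately have "(\<Sum>i. ?c i powr s) powr (1/s) \<le> (2 powr s * K powr s * (?A + ?B)) powr (1/s)"
      using \<open>0 < s\<close> by (intro powr_mono2) auto
    also have "\<dots> = 2 * K * (?A + ?B) powr (1/s)"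
      using \<open>0 < s\<close> AB X.K_ge_1 by (simp add: powr_mult powr_powr)
    also have "\<dots> \<le> 2 * K * (2 powr (1/s) * (?A powr (1/s) + ?B powr (1/s)))"
      using \<open>0 < s\<close> AB X.K_ge_1 by (intro mult_left_mono powr_add_le) auto
    finally show ?thesis using S(1) mem by (simp add: algebra_simps)
  qed
  have smult: "smult (ell_of s X) c x \<in> carrier (ell_of s X) \<and>
      qnorm (ell_of s X) (smult (ell_of s X) c x) = norm c * qnorm (ell_of s X) x"
    if x: "x \<in> carrier (ell_of s X)" for c x
  proof -
    have mem: "x i \<in> carrier X" for i using x by auto
    have sx: "summable (\<lambda>i. qnorm X (x i) powr s)" using x by auto
    have p: "qnorm X (smult X c (x i)) powr s = norm c powr s * qnorm X (x i) powr s" for i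
      using X.qnorm_smult[OF mem] X.qnorm_nonneg[OF mem] by (simp add: powr_mult)
    have "((\<Sum>i. norm c powr s * qnorm X (x i) powr s)) powr (1/s) = norm c * (\<Sum>i. qnorm X (x i) powr s) powr (1/s)"
      using \<open>0 < s\<close> sx by (simp add: suminf_mult powr_mult powr_powr suminf_nonneg)
    then show ?thesis using X.smult_mem mem sx by (auto simp: p intro: summable_mult)
  qed
  show ?thesis
  proof
    have "1 \<le> (2::real) powr (1/s)" using \<open>0 < s\<close> by (simp add: ge_one_powr_ge_zero)
    then have "1 * 1 \<le> 2 * 2 powr (1/s) * K"
      using X.K_ge_1 by (intro mult_mono) auto
    then show "1 \<le> 2 * 2 powr (1/s) * K" by simp
    show "0 \<in> carrier (ell_of s X)" using X.zero_mem by simp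
  next
    fix x assume x: "x \<in> carrier (ell_of s X)"
    show "smult (ell_of s X) (- 1) x = - x"
      using x X.smult_minus_one by (auto simp: fun_eq_iff)
    show "0 \<le> qnorm (ell_of s X) x" by simp
    have sx: "summable (\<lambda>i. qnorm X (x i) powr s)" using x by auto
    have "qnorm (ell_of s X) x = 0 \<longleftrightarrow> (\<forall>i. qnorm X (x i) powr s = 0)"
      using suminf_eq_zero_iff[OF sx] by simp
    also have "\<dots> \<longleftrightarrow> x = 0"
      using x X.qnorm_eq_0_iff by (auto simp: fun_eq_iff)
    finally show "qnorm (ell_of s X) x = 0 \<longleftrightarrow> x = 0" .
  qed (use add smult in blast)+
qed

lemma qnorm_coordinate_le:
  assumes "quasi_normed X K" "0 < s" "x \<in> carrier (ell_of s X)"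
  shows "qnorm X (x i) \<le> qnorm (ell_of s X) x"
proof -
  interpret X: quasi_normed X K by fact
  have "qnorm X (x i) powr s \<le> (\<Sum>i. qnorm X (x i) powr s)"
    using assms sum_le_suminf[of "\<lambda>i. qnorm X (x i) powr s" "{i}"] by (simp add: ell_of_def)
  then have "(qnorm X (x i) powr s) powr (1/s) \<le> (\<Sum>i. qnorm X (x i) powr s) powr (1/s)"
    using assms(2) by (intro powr_mono2) auto
  then show ?thesis
    using assms X.qnorm_nonneg by (simp add: ell_of_def powr_powr)
qed

lemma quasi_normed_ell: "0 < p \<Longrightarrow> quasi_normed (ell p) (2 * 2 powr (1/p))"
  using quasi_normed_ell_of[OF quasi_normed_scalars] by (simp add: ell_eq)

lemma quasi_normed_c_zero: "quasi_normed (c_zero :: ('k::real_normed_field, nat \<Rightarrow> 'k) qn_space) 1"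
proof
  let ?X = "c_zero :: ('k, nat \<Rightarrow> 'k) qn_space"
  note [simp] = c_zero_def
  have bdd: "bdd_above (range (\<lambda>n. norm (x n)))" if "x \<in> carrier ?X" for x
  proof -
    have "Bseq x" by (rule convergent_imp_Bseq[OF convergentI]) (use that in simp)
    then obtain M where "\<And>n. norm (x n) \<le> M" unfolding Bseq_def by blast
    then show ?thesis by (auto simp: bdd_above_def)
  qed
  show "0 \<in> carrier ?X" by (simp add: zero_fun_def)
  fix x y :: "nat \<Rightarrow> 'k" and c :: 'k assume x: "x \<in> carrier ?X"
  show "smult ?X c x \<in> carrier ?X"
    using x tendsto_mult_right_zero[of x sequentially c] by simp
  show "smult ?X (- 1) x = - x" by (simp add: fun_eq_iff)
  have up: "norm (x n) \<le> qnorm ?X x" for n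
    using bdd[OF x] by (auto intro: cSUP_upper)
  show nn: "0 \<le> qnorm ?X x" using up[of 0] norm_ge_zero order_trans by blast
  show "qnorm ?X x = 0 \<longleftrightarrow> x = 0"
    using up by (auto simp: fun_eq_iff)
  show "qnorm ?X (smult ?X c x) = norm c * qnorm ?X x"
  proof (cases "c = 0")
    case False
    have "(SUP n. norm (c * x n)) \<le> norm c * qnorm ?X x"
      using up by (intro cSUP_least) (auto simp: norm_mult intro!: mult_left_mono)
    moreover have "qnorm ?X x \<le> (SUP n. norm (c * x n)) / norm c"
    proof -
      have "bdd_above (range (\<lambda>n. norm (c * x n)))"
        using bdd[of "smult ?X c x"] x tendsto_mult_right_zero[of x sequentially c] by simp
      then have "norm (c * x n) \<le> (SUP n. norm (c * x n))" for n by (auto intro: cSUP_upper)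
      then have "norm (x n) \<le> (SUP n. norm (c * x n)) / norm c" for n
        using False by (simp add: norm_mult field_simps)
      then show ?thesis by (auto intro: cSUP_least)
    qed
    ultimately show ?thesis using False by (simp add: field_simps)
  qed simp
  assume y: "y \<in> carrier ?X"
  show "x + y \<in> carrier ?X"
    using tendsto_add[of x 0 sequentially y 0] x y by (simp add: plus_fun_def)
  have "norm (y n) \<le> qnorm ?X y" for n
    using bdd[OF y] by (auto intro: cSUP_upper)
  then have "norm (x n + y n) \<le> qnorm ?X x + qnorm ?X y" for n
    using up[of n] norm_triangle_ineq[of "x n" "y n"] add_mono order_trans by blast
  then show "qnorm ?X (x + y) \<le> 1 * (qnorm ?X x + qnorm ?X y)"
    by (auto intro!: cSUP_least)
qed auto

section \<open>Which sequence spaces embed\<close>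

lemma carrier_ell_ell_eq_mixed:
  "carrier (ell_of s (ell r)) = (mixed r (s / r) :: (nat \<Rightarrow> nat \<Rightarrow> 'k::real_normed_field) set)"
  by (auto simp: ell_of_def ell_def mixed_def power_sum_def powr_powr)

lemma qnorm_ell_powr: "0 < r \<Longrightarrow> x \<in> carrier (ell r) \<Longrightarrow> qnorm (ell r) x powr r = power_sum r x"
  by (simp add: ell_def power_sum_def powr_powr suminf_nonneg)

lemma qnorm_ell_ell_powr:
  assumes "0 < s" "x \<in> carrier (ell_of s (ell r))"
  shows "qnorm (ell_of s (ell r)) x powr s = energy r (s / r) x"
proof -
  have "summable (\<lambda>i. power_sum r (x i) powr (s / r))"
    using assms(2) by (simp add: carrier_ell_ell_eq_mixed mixed_def)
  then show ?thesis
    using assms(1) by (simp add: ell_of_def ell_def energy_def power_sum_def powr_powr suminf_nonneg)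
qed

lemma norm_entry_le:
  assumes "0 < r" "0 < s" "x \<in> carrier (ell_of s (ell r))"
  shows "norm (x i j) \<le> qnorm (ell_of s (ell r)) x"
proof -
  have "x i \<in> carrier (ell_of r scalars)"
    using assms(3) by (simp add: ell_of_def[of s] flip: ell_eq)
  from qnorm_coordinate_le[OF quasi_normed_scalars assms(1) this, of j]
  have "norm (x i j) \<le> qnorm (ell r) (x i)"
    by (simp add: ell_eq scalars_def)
  also have "\<dots> \<le> qnorm (ell_of s (ell r)) x"
    by (rule qnorm_coordinate_le[OF quasi_normed_ell[OF assms(1)] assms(2,3)])
  finally show ?thesis .
qed

lemma pointwise_convergent_subsequence:
  fixes f :: "nat \<Rightarrow> 'a::countable \<Rightarrow> 'b::{real_normed_vector, heine_borel}"
  assumes "\<And>n x. norm (f n x) \<le> M"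
  shows "\<exists>k. strict_mono k \<and> (\<forall>x. \<exists>z. (\<lambda>n. f (k n) x) \<longlonglongrightarrow> z)"
proof (rule function_convergent_subsequence[of UNIV f M])
  fix k :: "nat \<Rightarrow> nat"
  assume "strict_mono k" "\<And>x. x \<in> UNIV \<Longrightarrow> \<exists>z. (\<lambda>n. f (k n) x) \<longlonglongrightarrow> z"
  then show ?thesis by blast
qed (use assms in auto)

text \<open>Bounded sequences in \<open>\<ell>\<^sub>s(\<ell>\<^sub>r)\<close> have subsequences that converge in every entry, and differences of
  consecutive terms of such a subsequence are coordinatewise null.  Taking differences explains the
  two index sets \<open>A\<close> and \<open>B\<close>; a second extraction makes the row sums and the energies converge.\<close>

lemma sequence_growth_exponent:
  fixes y :: "nat \<Rightarrow> nat \<Rightarrow> nat \<Rightarrow> 'k::{real_normed_field, heine_borel}" and r s :: real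
  defines "Y \<equiv> ell_of s (ell r)"
  assumes r: "0 < r" and s: "0 < s" and y: "\<And>n. y n \<in> carrier Y" and c: "0 < c"
    and lower: "\<And>A B. \<lbrakk>finite A; finite B; A \<inter> B = {}; A \<noteq> {}\<rbrakk>
      \<Longrightarrow> c * (card A + card B) powr \<theta> \<le> qnorm Y (sum y A - sum y B)"
    and upper: "\<And>A B. \<lbrakk>finite A; finite B; A \<inter> B = {}; A \<noteq> {}\<rbrakk>
      \<Longrightarrow> qnorm Y (sum y A - sum y B) \<le> C * (card A + card B) powr \<theta>"
  shows "\<theta> = 1 / r \<or> \<theta> = 1 / s"
proof -
  interpret R: quasi_normed "ell r :: ('k, nat \<Rightarrow> 'k) qn_space" "2 * 2 powr (1/r)"
    by (rule quasi_normed_ell[OF r])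
  interpret Y: quasi_normed Y "2 * 2 powr (1/s) * (2 * 2 powr (1/r))"
    unfolding Y_def by (rule quasi_normed_ell_of[OF quasi_normed_ell[OF r] s])
  have "norm (y n i j) \<le> C" for n i j
    using norm_entry_le[OF r s, of "y n" i j] y[of n] upper[of "{n}" "{}"] by (simp add: Y_def)
  then obtain k where k: "strict_mono k"
    "\<And>p. \<exists>z. (\<lambda>n. y (k n) (fst p) (snd p)) \<longlonglongrightarrow> z"
    using pointwise_convergent_subsequence[of "\<lambda>n p. y n (fst p) (snd p)" C] by blast
  define u where "u n = y (k (2 * n)) - y (k (2 * n + 1))" for n
  have sum_u: "sum u A = sum y ((\<lambda>n. k (2 * n)) ` A) - sum y ((\<lambda>n. k (2 * n + 1)) ` A)" for A
  proof -
    have "inj_on (\<lambda>n. k (2 * n)) A" "inj_on (\<lambda>n. k (2 * n + 1)) A"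
      using strict_mono_eq[OF k(1)] by (auto simp: inj_on_def)
    then show ?thesis by (simp add: u_def sum_subtractf sum.reindex)
  qed
  have card_u: "card ((\<lambda>n. k (2 * n)) ` A) + card ((\<lambda>n. k (2 * n + 1)) ` A) = 2 * card A" for A
    using strict_mono_eq[OF k(1)] by (subst (1 2) card_image) (auto simp: inj_on_def)
  have disjoint: "(\<lambda>n. k (2 * n)) ` A \<inter> (\<lambda>n. k (2 * n + 1)) ` A = {}" for A
    using strict_mono_eq[OF k(1)] by (auto; presburger)
  have lower_u: "c * (2 * card A) powr \<theta> \<le> qnorm Y (sum u A)"
    and upper_u: "qnorm Y (sum u A) \<le> C * (2 * card A) powr \<theta>" if "finite A" "A \<noteq> {}" for A
    using that lower[OF _ _ disjoint[of A]] upper[OF _ _ disjoint[of A]]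
    unfolding sum_u by (simp_all only: finite_imageI image_is_empty simp_thms card_u flip: of_nat_add)
  have u_mem: "u n \<in> carrier Y" for n
    unfolding u_def by (intro Y.diff_mem y)
  have u_row: "u n i \<in> carrier (ell r)" for n i
    using u_mem by (simp add: Y_def ell_of_def)
  have u_null: "(\<lambda>n. u n i j) \<longlonglongrightarrow> 0" for i j
  proof -
    obtain z where z: "(\<lambda>n. y (k n) i j) \<longlonglongrightarrow> z" using k(2)[of "(i, j)"] by auto
    have "strict_mono (\<lambda>n::nat. 2 * n)" "strict_mono (\<lambda>n::nat. 2 * n + 1)"
      by (auto simp: strict_mono_def)
    from tendsto_diff[OF this[THEN LIMSEQ_subseq_LIMSEQ[OF z]]]
    show ?thesis by (simp add: u_def o_def)
  qed
  define D where "D = C * 2 powr \<theta>"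
  have u_le: "qnorm Y (u n) \<le> D" for n
    using upper_u[of "{n}"] by (simp add: D_def)
  \<comment> \<open>\<open>None\<close> indexes the energy and \<open>Some i\<close> the sum of row \<open>i\<close>, so that one diagonal extraction
    serves both.\<close>
  define f where "f n i = (case i of None \<Rightarrow> energy r (s / r) (u n) | Some i \<Rightarrow> power_sum r (u n i))" for n i
  have f_bound: "norm (f n i) \<le> max (D powr s) (D powr r)" for n i
  proof (cases i)
    case None
    have "energy r (s / r) (u n) = qnorm Y (u n) powr s"
      using u_mem[of n] by (simp add: Y_def qnorm_ell_ell_powr[OF s])
    moreover have "qnorm Y (u n) powr s \<le> D powr s"
      using s u_le by (intro powr_mono2 Y.qnorm_nonneg u_mem) auto
    ultimately show ?thesis by (simp add: f_def None)
  next
    case (Some j)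
    have "power_sum r (u n j) = qnorm (ell r) (u n j) powr r"
      using qnorm_ell_powr[OF r u_row] by simp
    moreover have "qnorm (ell r) (u n j) \<le> qnorm Y (u n)"
      using qnorm_coordinate_le[OF quasi_normed_ell[OF r] s] u_mem[of n] by (simp add: Y_def)
    then have "qnorm (ell r) (u n j) powr r \<le> D powr r"
      using r u_le[of n] R.qnorm_nonneg[OF u_row] by (intro powr_mono2) auto
    ultimately show ?thesis by (simp add: f_def Some)
  qed
  have "\<exists>l. strict_mono l \<and> (\<forall>i. \<exists>z. (\<lambda>n. f (l n) i) \<longlonglongrightarrow> z)"
    by (rule pointwise_convergent_subsequence[OF f_bound])
  then obtain l where l: "strict_mono l" "\<forall>i. \<exists>z. (\<lambda>n. f (l n) i) \<longlonglongrightarrow> z" by blast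
  from choice[OF l(2)] obtain z where z: "\<And>i. (\<lambda>n. f (l n) i) \<longlonglongrightarrow> z i" by blast
  interpret coordinatewise_null r "s / r" "\<lambda>n. u (l n)" "\<lambda>i. z (Some i)" "z None"
  proof
    show "u (l n) \<in> mixed r (s / r)" for n
      using u_mem by (simp add: Y_def carrier_ell_ell_eq_mixed)
    show "(\<lambda>n. u (l n) i j) \<longlonglongrightarrow> 0" for i j
      using LIMSEQ_subseq_LIMSEQ[OF u_null l(1)] by (simp add: o_def)
    show "(\<lambda>n. power_sum r (u (l n) i)) \<longlonglongrightarrow> z (Some i)" for i
      using z[of "Some i"] by (simp add: f_def)
    show "(\<lambda>n. energy r (s / r) (u (l n))) \<longlonglongrightarrow> z None"
      using z[of None] by (simp add: f_def)
  qed (use r s in auto)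
  have bounds: "(c * 2 powr \<theta>) powr s * card A powr (s * \<theta>) \<le> energy r (s / r) (\<Sum>n\<in>A. u (l n))"
    "energy r (s / r) (\<Sum>n\<in>A. u (l n)) \<le> (C * 2 powr \<theta>) powr s * card A powr (s * \<theta>)"
    if A: "finite A" "A \<noteq> {}" for A
  proof -
    have inj: "inj_on l A" using strict_mono_eq[OF l(1)] by (auto simp: inj_on_def)
    let ?x = "\<Sum>n\<in>A. u (l n)"
    have x: "?x = sum u (l ` A)" using inj by (simp add: sum.reindex)
    have mem: "?x \<in> carrier Y" by (intro Y.sum_mem u_mem)
    have E: "energy r (s / r) ?x = qnorm Y ?x powr s"
      using mem by (simp add: Y_def qnorm_ell_ell_powr[OF s])
    have lo: "c * (2 * card A) powr \<theta> \<le> qnorm Y ?x" and up: "qnorm Y ?x \<le> C * (2 * card A) powr \<theta>"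
      using lower_u[of "l ` A"] upper_u[of "l ` A"] A inj by (simp_all add: x card_image)
    have C: "0 < C"
    proof -
      have "0 < card A" using A by (simp add: card_gt_0_iff)
      then have pos: "0 < real (2 * card A) powr \<theta>" by simp
      have "0 < c * real (2 * card A) powr \<theta>" by (rule mult_pos_pos[OF c pos])
      also have "\<dots> \<le> C * real (2 * card A) powr \<theta>" by (rule order_trans[OF lo up])
      finally show ?thesis by (rule zero_less_mult_pos2[OF _ pos])
    qed
    have split: "(b * 2 powr \<theta>) powr s * card A powr (s * \<theta>) = (b * (2 * card A) powr \<theta>) powr s" if "0 < b" for b
      using that by (simp add: powr_mult powr_powr mult_ac)
    show "(c * 2 powr \<theta>) powr s * card A powr (s * \<theta>) \<le> energy r (s / r) ?x"
      unfolding split[OF c] E using c s lo by (intro powr_mono2) auto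
    show "energy r (s / r) ?x \<le> (C * 2 powr \<theta>) powr s * card A powr (s * \<theta>)"
      unfolding split[OF C] E using s up Y.qnorm_nonneg[OF mem] by (intro powr_mono2) auto
  qed
  have "s * \<theta> = s / r \<or> s * \<theta> = 1"
    by (rule growth_exponent[OF _ bounds]) (use c in auto)
  then show ?thesis using r s by (auto simp: field_simps)
qed

text \<open>An isomorphic embedding changes quasi-norms by bounded factors only, so it preserves the exponent
  at which the quasi-norms of sums of basis vectors grow.\<close>

lemma embedding_growth_exponent:
  fixes X :: "('k::{real_normed_field, heine_borel}, 'v::ab_group_add) qn_space" and e :: "nat \<Rightarrow> 'v"
  assumes r: "0 < r" and s: "0 < s" and X: "quasi_normed X K"
    and e: "\<And>n. e n \<in> carrier X"
    and norms: "\<And>A B. \<lbrakk>finite A; finite B; A \<inter> B = {}; A \<noteq> {}\<rbrakk>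
      \<Longrightarrow> qnorm X (sum e A - sum e B) = (card A + card B) powr \<theta>"
    and emb: "isomorphically_embeds X (ell_of s (ell r))"
  shows "\<theta> = 1 / r \<or> \<theta> = 1 / s"
proof -
  interpret X: quasi_normed X K by fact
  have Y: "quasi_normed (ell_of s (ell r :: ('k, nat \<Rightarrow> 'k) qn_space)) (2 * 2 powr (1/s) * (2 * 2 powr (1/r)))"
    by (rule quasi_normed_ell_of[OF quasi_normed_ell[OF r] s])
  let ?Y = "ell_of s (ell r :: ('k, nat \<Rightarrow> 'k) qn_space)"
  obtain T where T: "linear_map_between X ?Y T" "embedding_map (qn_topology X) (qn_topology ?Y) T"
    using emb unfolding isomorphically_embeds_def by blast
  obtain c C where c: "0 < c" "0 < C"
    "\<And>x. x \<in> carrier X \<Longrightarrow> c * qnorm X x \<le> qnorm ?Y (T x)"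
    "\<And>x. x \<in> carrier X \<Longrightarrow> qnorm ?Y (T x) \<le> C * qnorm X x"
    using embedding_imp_equivalent_norms[OF X Y T] by blast
  have T_add: "T (a + b) = T a + T b" if "a \<in> carrier X" "b \<in> carrier X" for a b
    using T(1) that unfolding linear_map_between_def by blast
  have T_0: "T 0 = 0" using T_add[OF X.zero_mem X.zero_mem] by simp
  have T_sum: "T (sum e A) = (\<Sum>n\<in>A. T (e n))" for A
    by (induction A rule: infinite_finite_induct) (simp_all add: T_0 T_add X.sum_mem e)
  have T_diff: "T (sum e A - sum e B) = (\<Sum>n\<in>A. T (e n)) - (\<Sum>n\<in>B. T (e n))" for A B
  proof -
    have "T (sum e A - sum e B + sum e B) = T (sum e A - sum e B) + T (sum e B)"
      by (intro T_add X.diff_mem X.sum_mem e)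
    then show ?thesis by (simp add: T_sum algebra_simps)
  qed
  have mem: "sum e A - sum e B \<in> carrier X" for A B
    by (intro X.diff_mem X.sum_mem e)
  show ?thesis
  proof (rule sequence_growth_exponent[OF r s _ c(1), where y="\<lambda>n. T (e n)" and C=C])
    show "T (e n) \<in> carrier ?Y" for n
      using T(1) e[of n] by (auto simp: linear_map_between_def)
    fix A B :: "nat set" assume AB: "finite A" "finite B" "A \<inter> B = {}" "A \<noteq> {}"
    show "c * (card A + card B) powr \<theta> \<le> qnorm ?Y ((\<Sum>n\<in>A. T (e n)) - (\<Sum>n\<in>B. T (e n)))"
      using c(3)[OF mem, of A B] norms[OF AB] by (simp add: T_diff)
    show "qnorm ?Y ((\<Sum>n\<in>A. T (e n)) - (\<Sum>n\<in>B. T (e n))) \<le> C * (card A + card B) powr \<theta>"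
      using c(4)[OF mem, of A B] norms[OF AB] by (simp add: T_diff)
  qed
qed

definition unit_seq :: "nat \<Rightarrow> nat \<Rightarrow> 'k::real_normed_field" where
  "unit_seq n = (\<lambda>j. if j = n then 1 else 0)"

lemma norm_unit_seq_sums:
  assumes "finite A" "finite B" "A \<inter> B = {}"
  shows "norm (sum unit_seq A j - sum unit_seq B j :: 'k::real_normed_field) = (if j \<in> A \<union> B then 1 else 0)"
proof -
  have "sum unit_seq F j = (if j \<in> F then 1 else (0::'k))" if "finite F" for F j
    using that by (induction F) (auto simp: unit_seq_def)
  then show ?thesis using assms by auto
qed

text \<open>In \<open>\<ell>\<^sub>p\<close> a sum of \<open>n\<close> signed unit vectors has quasi-norm \<open>n powr (1 / p)\<close>.\<close>

lemma ell_embeds_imp: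
  assumes r: "0 < r" and s: "0 < s" and p: "0 < p"
    and emb: "isomorphically_embeds (ell p :: ('k::{real_normed_field, heine_borel}, nat \<Rightarrow> 'k) qn_space) (ell_of s (ell r :: ('k, nat \<Rightarrow> 'k) qn_space))"
  shows "p = r \<or> p = s"
proof -
  have "1 / p = 1 / r \<or> 1 / p = 1 / s"
  proof (rule embedding_growth_exponent[OF r s quasi_normed_ell[OF p] _ _ emb, where e=unit_seq])
    have "(\<lambda>j. norm (unit_seq n j :: 'k) powr p) = (\<lambda>j. if j = n then 1 else 0)" for n
      by (auto simp: unit_seq_def)
    then show "unit_seq n \<in> carrier (ell p :: ('k, nat \<Rightarrow> 'k) qn_space)" for n
      by (simp add: ell_def)
    fix A B :: "nat set" assume AB: "finite A" "finite B" "A \<inter> B = {}"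
    have "(\<lambda>j. norm ((sum unit_seq A - sum unit_seq B) j :: 'k) powr p) = (\<lambda>j. if j \<in> A \<union> B then 1 else 0)"
      by (auto simp: norm_unit_seq_sums[OF AB])
    then have "(\<lambda>j. norm ((sum unit_seq A - sum unit_seq B) j :: 'k) powr p) sums real (card (A \<union> B))"
      using sums_If_finite_set[of "A \<union> B" "\<lambda>_. 1::real"] AB by simp
    then show "qnorm (ell p) (sum unit_seq A - sum unit_seq B :: nat \<Rightarrow> 'k) = (card A + card B) powr (1 / p)"
      using AB by (simp add: ell_def sums_iff card_Un_disjoint)
  qed
  then show ?thesis using r s p by auto
qed

text \<open>In \<open>c\<^sub>0\<close> such sums have norm \<open>1\<close>, which is growth with exponent \<open>0\<close>.\<close>

lemma not_c_zero_embeds: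
  assumes r: "0 < r" and s: "0 < s"
  shows "\<not> isomorphically_embeds (c_zero :: ('k::{real_normed_field, heine_borel}, nat \<Rightarrow> 'k) qn_space) (ell_of s (ell r :: ('k, nat \<Rightarrow> 'k) qn_space))"
proof
  assume emb: "isomorphically_embeds (c_zero :: ('k, nat \<Rightarrow> 'k) qn_space) (ell_of s (ell r :: ('k, nat \<Rightarrow> 'k) qn_space))"
  have "0 = 1 / r \<or> 0 = 1 / s"
  proof (rule embedding_growth_exponent[OF r s quasi_normed_c_zero _ _ emb, where e=unit_seq])
    show "unit_seq n \<in> carrier (c_zero :: ('k, nat \<Rightarrow> 'k) qn_space)" for n
      unfolding c_zero_def unit_seq_def
      by (auto intro!: tendsto_eventually eventually_sequentiallyI[of "Suc n"])
    fix A B :: "nat set" assume AB: "finite A" "finite B" "A \<inter> B = {}" and A: "A \<noteq> {}"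
    have "(SUP j. norm ((sum unit_seq A - sum unit_seq B) j :: 'k)) = 1"
    proof (rule cSup_eq_maximum)
      show "1 \<in> range (\<lambda>j. norm ((sum unit_seq A - sum unit_seq B) j :: 'k))"
        using A by (force simp: norm_unit_seq_sums[OF AB])
    qed (auto simp: norm_unit_seq_sums[OF AB])
    moreover have "card A \<noteq> 0" using AB A by simp
    ultimately show "qnorm c_zero (sum unit_seq A - sum unit_seq B :: nat \<Rightarrow> 'k) = (card A + card B) powr 0"
      by (simp add: c_zero_def flip: of_nat_add)
  qed
  then show False using r s by simp
qed

lemma closedin_qn_topologyI:
  assumes "\<And>x. x \<in> carrier X \<Longrightarrow> \<not> P x \<Longrightarrow> \<exists>e>0. \<forall>y\<in>carrier X. qnorm X (y - x) < e \<longrightarrow> \<not> P y"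
  shows "closedin (qn_topology X) {x \<in> carrier X. P x}"
proof -
  have "carrier X - {x \<in> carrier X. P x} = {x \<in> carrier X. \<not> P x}" by auto
  then show ?thesis
    using assms by (auto simp: closedin_def topspace_qn_topology openin_qn_topology)
qed

text \<open>The image of \<open>X\<close> consists of the sequences that vanish from index \<open>1\<close> on.  It is closed because
  each coordinate is bounded by the quasi-norm.\<close>

lemma embeds_in_ell_of:
  fixes X :: "('k::real_normed_field, 'v::ab_group_add) qn_space"
  assumes X: "quasi_normed X K" and s: "0 < s"
  shows "isomorphically_embeds X (ell_of s X)"
proof -
  interpret X: quasi_normed X K by fact
  have Y: "quasi_normed (ell_of s X) (2 * 2 powr (1/s) * K)"
    by (rule quasi_normed_ell_of[OF X s])
  interpret Y: quasi_normed "ell_of s X" "2 * 2 powr (1/s) * K" by (rule Y)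
  define T where "T x = (\<lambda>i::nat. if i = 0 then x else 0)" for x :: 'v
  have pw: "(\<lambda>i. qnorm X (T x i) powr s) = (\<lambda>i. if i = 0 then qnorm X x powr s else 0)" for x
    by (auto simp: T_def)
  have sums: "(\<lambda>i. qnorm X (T x i) powr s) sums (qnorm X x powr s)" for x
    unfolding pw using sums_single[of 0 "\<lambda>_. qnorm X x powr s"] by simp
  have mem: "T x \<in> carrier (ell_of s X)" if "x \<in> carrier X" for x
    using that sums[of x] X.zero_mem by (auto simp: ell_of_def sums_iff T_def)
  have smult0: "smult X c 0 = 0" for c
    using X.qnorm_eq_0_iff[OF X.smult_mem[OF X.zero_mem]] X.qnorm_smult[OF X.zero_mem] by simp
  show ?thesis
  proof (rule isometry_imp_embeds[OF X Y])
    show "linear_map_between X (ell_of s X) T"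
      using mem by (auto simp: linear_map_between_def fun_eq_iff) (auto simp: T_def ell_of_def smult0)
    show "qnorm (ell_of s X) (T x) = qnorm X x" if "x \<in> carrier X" for x
      using sums[of x] s X.qnorm_nonneg[OF that] by (simp add: ell_of_def sums_iff powr_powr)
    have "T ` carrier X = {y \<in> carrier (ell_of s X). \<forall>i>0. y i = 0}"
    proof (intro equalityI subsetI)
      fix y assume y: "y \<in> {y \<in> carrier (ell_of s X). \<forall>i>0. y i = 0}"
      then have "y = T (y 0)" by (auto simp: T_def)
      moreover have "y 0 \<in> carrier X" using y by (simp add: ell_of_def)
      ultimately show "y \<in> T ` carrier X" by blast
    qed (use mem in \<open>auto simp: T_def\<close>)
    also have "closedin (qn_topology (ell_of s X)) \<dots>"
    proof (rule closedin_qn_topologyI)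
      fix x assume x: "x \<in> carrier (ell_of s X)" "\<not> (\<forall>i>0. x i = 0)"
      then obtain i where i: "i > 0" "x i \<noteq> 0" by blast
      have xi: "x i \<in> carrier X" using x by (simp add: ell_of_def)
      show "\<exists>e>0. \<forall>y\<in>carrier (ell_of s X). qnorm (ell_of s X) (y - x) < e \<longrightarrow> \<not> (\<forall>i>0. y i = 0)"
      proof (intro exI[of _ "qnorm X (x i)"] conjI ballI impI notI)
        show "0 < qnorm X (x i)"
          using X.qnorm_nonneg[OF xi] X.qnorm_eq_0_iff[OF xi] i by simp
        fix y assume y: "y \<in> carrier (ell_of s X)" "qnorm (ell_of s X) (y - x) < qnorm X (x i)"
          "\<forall>i>0. y i = 0"
        have "qnorm X (- x i) = qnorm X (x i)"
          using X.qnorm_smult[OF xi, of "-1"] X.smult_minus_one[OF xi] by simp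
        then show False
          using qnorm_coordinate_le[OF X s Y.diff_mem[OF y(1) x(1)], of i] y i by simp
      qed
    qed
    finally show "closedin (qn_topology (ell_of s X)) (T ` carrier X)" .
  qed
qed

text \<open>The image of \<open>\<ell>\<^sub>s\<close> consists of the double sequences that are supported in the first inner
  coordinate.\<close>

lemma outer_ell_embeds:
  fixes r s :: real
  assumes r: "0 < r" and s: "0 < s"
  shows "isomorphically_embeds (ell s) (ell_of s (ell r :: ('k::real_normed_field, nat \<Rightarrow> 'k) qn_space))"
proof -
  let ?Y = "ell_of s (ell r :: ('k, nat \<Rightarrow> 'k) qn_space)"
  have Y: "quasi_normed ?Y (2 * 2 powr (1/s) * (2 * 2 powr (1/r)))"
    by (rule quasi_normed_ell_of[OF quasi_normed_ell[OF r] s])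
  interpret Y: quasi_normed ?Y "2 * 2 powr (1/s) * (2 * 2 powr (1/r))" by (rule Y)
  define T where "T x = (\<lambda>i j::nat. if j = 0 then x i else 0)" for x :: "nat \<Rightarrow> 'k"
  have pw: "(\<lambda>j. norm (T x i j) powr r) = (\<lambda>j. if j = 0 then norm (x i) powr r else 0)" for x i
    by (auto simp: T_def)
  have sums: "(\<lambda>j. norm (T x i j) powr r) sums (norm (x i) powr r)" for x i
    unfolding pw using sums_single[of 0 "\<lambda>_. norm (x i) powr r"] by simp
  have row: "T x i \<in> carrier (ell r)" "qnorm (ell r) (T x i) = norm (x i)" for x i
    using sums[of x i] r by (auto simp: ell_def sums_iff powr_powr)
  have mem: "T x \<in> carrier ?Y" if "x \<in> carrier (ell s)" for x
    using that row by (simp add: ell_of_def) (simp add: ell_def)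
  show ?thesis
  proof (rule isometry_imp_embeds[OF quasi_normed_ell[OF s] Y])
    show "linear_map_between (ell s) ?Y T"
      using mem by (auto simp: linear_map_between_def fun_eq_iff) (auto simp: T_def ell_of_def ell_def)
    show "qnorm ?Y (T x) = qnorm (ell s) x" for x
      using row by (simp add: ell_of_def) (simp add: ell_def)
    have "T ` carrier (ell s) = {y \<in> carrier ?Y. \<forall>i. \<forall>j>0. y i j = 0}"
    proof (intro equalityI subsetI)
      fix y assume y: "y \<in> {y \<in> carrier ?Y. \<forall>i. \<forall>j>0. y i j = 0}"
      then have T: "y = T (\<lambda>i. y i 0)" by (auto simp: T_def fun_eq_iff)
      then have "qnorm (ell r) (y i) = norm (y i 0)" for i
        using row(2)[of "\<lambda>i. y i 0" i] by simp
      then have "(\<lambda>i. y i 0) \<in> carrier (ell s)" using y by (simp add: ell_of_def) (simp add: ell_def)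
      with T show "y \<in> T ` carrier (ell s)" by blast
    qed (use mem in \<open>auto simp: T_def\<close>)
    also have "closedin (qn_topology ?Y) \<dots>"
    proof (rule closedin_qn_topologyI)
      fix x assume x: "x \<in> carrier ?Y" "\<not> (\<forall>i. \<forall>j>0. x i j = 0)"
      then obtain i j where ij: "j > 0" "x i j \<noteq> 0" by blast
      show "\<exists>e>0. \<forall>y\<in>carrier ?Y. qnorm ?Y (y - x) < e \<longrightarrow> \<not> (\<forall>i. \<forall>j>0. y i j = 0)"
      proof (intro exI[of _ "norm (x i j)"] conjI ballI impI notI)
        fix y assume y: "y \<in> carrier ?Y" "qnorm ?Y (y - x) < norm (x i j)" "\<forall>i. \<forall>j>0. y i j = 0"
        then show False
          using norm_entry_le[OF r s Y.diff_mem[OF y(1) x(1)], of i j] ij by simp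
      qed (use ij in auto)
    qed
    finally show "closedin (qn_topology ?Y) (T ` carrier (ell s))" .
  qed
qed

text \<open>The class \<open>heine_borel\<close> provides the compactness for the extraction of subsequences and covers the
  real and the complex field.\<close>

lemma Lambda_ell_of_ell:
  fixes r s :: real
  assumes r: "0 < r" and s: "0 < s"
  shows "Lambda (ell_of s (ell r :: ('k::{real_normed_field, heine_borel}, nat \<Rightarrow> 'k) qn_space)) = {ereal r, ereal s}"
    (is "Lambda ?Y = _")
proof (intro equalityI subsetI)
  fix p assume "p \<in> Lambda ?Y"
  then have p: "0 < p" and emb: "isomorphically_embeds
      (if p = \<infinity> then c_zero else ell (real_of_ereal p) :: ('k, nat \<Rightarrow> 'k) qn_space) ?Y"
    by (auto simp: Lambda_def)
  show "p \<in> {ereal r, ereal s}"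
  proof (cases p)
    case (real q)
    then have "isomorphically_embeds (ell q) ?Y" "0 < q" using emb p by auto
    then show ?thesis using ell_embeds_imp[OF r s] real by blast
  next
    case PInf
    then show ?thesis using emb not_c_zero_embeds[OF r s, where 'k='k] by simp
  qed (use p in auto)
next
  fix p assume "p \<in> {ereal r, ereal s}"
  then show "p \<in> Lambda ?Y"
  proof
    assume "p = ereal r"
    then show ?thesis
      using embeds_in_ell_of[OF quasi_normed_ell[OF r] s] r by (simp add: Lambda_def)
  next
    assume "p \<in> {ereal s}"
    then show ?thesis
      using outer_ell_embeds[OF r s] s by (simp add: Lambda_def)
  qed
qed

theorem theorem3p2:
  fixes r s :: real
  assumes "0 < r" and "0 < s"
  shows "Lambda (ell_of s (ell r :: (real, nat \<Rightarrow> real) qn_space)) = {ereal r, ereal s} \<and>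
         Lambda (ell_of s (ell r :: (complex, nat \<Rightarrow> complex) qn_space)) = {ereal r, ereal s}"
  by (intro conjI Lambda_ell_of_ell assms)

end
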